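(* If $G$ is a string graph, then $\mathsf{c}(G)\leq 13$.
   Context: All graphs are finite, simple, undirected and connected. A string graph is a graph $G$ for which there is a family of simple curves (continuous images of $[0,1]$) in $\mathbb{R}^2$, one curve $\psi(v)$ per vertex $v$, such that $uv\in E(G)$ if and only if $\psi(u)\cap\psi(v)\neq\emptyset$. In the game of Cops and Robber on $G$, the cop player first places some cops on vertices (several may share a vertex), then the robber chooses a vertex; then the players alternate, starting with the cops: in a cop move each cop moves to an adjacent vertex or stays, and in a robber move the robber moves to an adjacent vertex or stays. The cops win if at some point a cop occupies the same vertex as the robber. The cop number $\mathsf{c}(G)$ is the minimum number of cops that guarantees a win against every robber strategy. *)

theory Defs
  imports "HOL-Analysis.Analysis" "Graph_Theory.Digraph_Component"
begin

text \<open>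
  A finite simple undirected graph is a \<^locale>\<open>pair_graph\<close>: the arc set of \<open>G\<close> is finite,
  irreflexive and symmetric, and an edge \<open>uv\<close> is represented by the two arcs \<open>(u, v)\<close> and \<open>(v, u)\<close>.
\<close>

text \<open>
  \<^const>\<open>simple_path\<close> also admits closed curves. The loop \<open>u = v\<close> is excluded since a simple graph
  has no loops, although every curve meets itself.
\<close>

definition string_graph :: "'a pair_pre_digraph \<Rightarrow> bool" where
  "string_graph G \<longleftrightarrow>
    (\<exists>\<psi> :: 'a \<Rightarrow> real \<Rightarrow> real ^ 2.
      (\<forall>v\<in>pverts G. simple_path (\<psi> v)) \<and>
      (\<forall>u\<in>pverts G. \<forall>v\<in>pverts G. u \<noteq> v \<longrightarrow>
        ((u, v) \<in> parcs G \<longleftrightarrow> path_image (\<psi> u) \<inter> path_image (\<psi> v) \<noteq> {})))"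

text \<open>
  The positions of \<open>k\<close> cops form a list of length \<open>k\<close>, whose \<open>i\<close>-th entry is the vertex of the
  \<open>i\<close>-th cop. A history \<open>(cs, rs)\<close> lists the successive positions of the cops and of the robber,
  oldest first, the initial ones included.
\<close>

definition placement :: "'a pair_pre_digraph \<Rightarrow> nat \<Rightarrow> 'a list \<Rightarrow> bool" where
  "placement G k C \<longleftrightarrow> length C = k \<and> set C \<subseteq> pverts G"

definition step :: "'a pair_pre_digraph \<Rightarrow> 'a \<Rightarrow> 'a \<Rightarrow> bool" where
  "step G u v \<longleftrightarrow> u = v \<or> (u, v) \<in> parcs G"

text \<open>
  Strategies may depend on the whole history. They are total functions, required to answer with a
  legal move in every history whose last position is legal; histories that never arise do no harm,
  since staying put is always legal.
\<close>

type_synonym 'a cop_strategy = "'a list list \<Rightarrow> 'a list \<Rightarrow> 'a list"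
type_synonym 'a robber_strategy = "'a list list \<Rightarrow> 'a list \<Rightarrow> 'a"

definition legal_cop_strategy :: "'a pair_pre_digraph \<Rightarrow> nat \<Rightarrow> 'a cop_strategy \<Rightarrow> bool" where
  "legal_cop_strategy G k \<sigma> \<longleftrightarrow>
    placement G k (\<sigma> [] []) \<and>
    (\<forall>cs rs. cs \<noteq> [] \<longrightarrow> placement G k (last cs) \<longrightarrow> list_all2 (step G) (last cs) (\<sigma> cs rs))"

definition legal_robber_strategy :: "'a pair_pre_digraph \<Rightarrow> 'a robber_strategy \<Rightarrow> bool" where
  "legal_robber_strategy G \<rho> \<longleftrightarrow>
    (\<forall>cs. \<rho> cs [] \<in> pverts G) \<and>
    (\<forall>cs rs. rs \<noteq> [] \<longrightarrow> last rs \<in> pverts G \<longrightarrow> step G (last rs) (\<rho> cs rs))"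

text \<open>
  The history after \<open>n\<close> rounds. The first round consists of the two placements; in each round the
  robber sees the new positions of the cops before he answers.
\<close>

fun play :: "'a cop_strategy \<Rightarrow> 'a robber_strategy \<Rightarrow> nat \<Rightarrow> 'a list list \<times> 'a list" where
  "play \<sigma> \<rho> 0 = ([], [])"
| "play \<sigma> \<rho> (Suc n) =
    (let (cs, rs) = play \<sigma> \<rho> n; cs' = cs @ [\<sigma> cs rs] in (cs', rs @ [\<rho> cs' rs]))"

text \<open>
  A capture happens either after a turn of the robber, when he is on a vertex of \<open>last cs\<close>, or
  after the next turn of the cops, who are then at \<open>\<sigma> cs rs\<close>.
\<close>

definition cops_win :: "'a cop_strategy \<Rightarrow> 'a robber_strategy \<Rightarrow> bool" where
  "cops_win \<sigma> \<rho> \<longleftrightarrow>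
    (\<exists>n\<ge>1. let (cs, rs) = play \<sigma> \<rho> n in last rs \<in> set (last cs) \<or> last rs \<in> set (\<sigma> cs rs))"

definition cops_suffice :: "'a pair_pre_digraph \<Rightarrow> nat \<Rightarrow> bool" where
  "cops_suffice G k \<longleftrightarrow>
    (\<exists>\<sigma>. legal_cop_strategy G k \<sigma> \<and> (\<forall>\<rho>. legal_robber_strategy G \<rho> \<longrightarrow> cops_win \<sigma> \<rho>))"

definition cop_number :: "'a pair_pre_digraph \<Rightarrow> nat" where
  "cop_number G = (LEAST k. cops_suffice G k)"

text \<open>The minimum is attained: one cop on every vertex wins at once.\<close>

lemma cops_suffice_card_pverts:
  assumes "finite (pverts G)"
  shows "cops_suffice G (card (pverts G))"
proof -
  obtain C where C: "set C = pverts G" "length C = card (pverts G)"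
    using assms finite_distinct_list distinct_card by metis
  define \<sigma> :: "'a cop_strategy" where "\<sigma> = (\<lambda>cs rs. if cs = [] then C else last cs)"
  have "legal_cop_strategy G (card (pverts G)) \<sigma>"
    using C by (auto simp: legal_cop_strategy_def placement_def \<sigma>_def step_def list_all2_same)
  moreover have "cops_win \<sigma> \<rho>" if "legal_robber_strategy G \<rho>" for \<rho>
    using that C unfolding cops_win_def legal_robber_strategy_def
    by (intro exI[of _ 1]) (auto simp: Let_def \<sigma>_def)
  ultimately show ?thesis
    unfolding cops_suffice_def by blast
qed

lemma cops_suffice_cop_number:
  assumes "finite (pverts G)"
  shows "cops_suffice G (cop_number G)"
  unfolding cop_number_def using cops_suffice_card_pverts[OF assms] by (rule LeastI)

end

theory Submission
  imports Defs
begin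

text \<open>
  The curves are replaced by finite connected sets of points of the triangular lattice, which
  together cover a box, the frame of the box belonging to a single vertex. The robber is kept inside
  the fundamental cycle of a lattice edge \<open>xy\<close> with respect to a tree of lattice points; the two tree
  paths from \<open>x\<close> and from \<open>y\<close> to the root are guarded by four cops each. A path from the third corner
  \<open>z\<close> of the triangle at \<open>xy\<close> to the tree is guarded by four more cops; it cuts the enclosed disc into
  two smaller ones, and one of the three paths can be released. So twelve cops suffice.

  Four cops per path are enough because the path is chosen greedily for a distance \<open>D\<close> on points, not
  on vertices: \<open>D\<close> counts the vertices of \<open>G\<close> used by a lattice walk. A point of the path with
  label \<open>j\<close> lies on the \<open>j\<close>-th vertex of a walk in \<open>G\<close>, and a lattice set through that point
  reaches, inside the territory, only points at distance between \<open>j - 1\<close> and \<open>j + 1\<close>. When \<open>D\<close> is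
  recomputed in a smaller territory, the labels on the old tree are kept, which is possible since
  they extend to a 1-Lipschitz function on the territory.
\<close>

section \<open>The triangular lattice\<close>

text \<open>The obstacle is that a curve may leave the robber's territory and return, so that one
  vertex of \<open>G\<close> can have several pieces in the territory, far apart in the game that is
  left. A distance on vertices would treat such a vertex as a shortcut. Hence steps are counted by
  \<open>hop\<close>, which follows one set only as long as it stays in the territory, and labels
  sit on points. Four is the width of a window: the set of the robber carries at most two
  consecutive labels, and a point where his next set crosses the path is one hop away from it, which
  adds one label at either end. Planarity enters through chains of triangles modulo 2: every finite
  cycle of edges bounds exactly one finite set of triangles, which serves as its interior. Every cut
  removes at least one triangle from this set, so the cuts come to an end.\<close>

type_synonym point = "int \<times> int"

datatype direction = Hor | Ver | Dia

type_synonym edge = "direction \<times> point"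
type_synonym triangle = "bool \<times> point"

fun ends :: "edge \<Rightarrow> point set" where
  "ends (Hor, a, b) = {(a, b), (a + 1, b)}"
| "ends (Ver, a, b) = {(a, b), (a, b + 1)}"
| "ends (Dia, a, b) = {(a, b), (a + 1, b + 1)}"

fun corners :: "triangle \<Rightarrow> point set" where
  "corners (False, a, b) = {(a, b), (a + 1, b), (a + 1, b + 1)}"
| "corners (True, a, b) = {(a, b), (a, b + 1), (a + 1, b + 1)}"

fun side1 :: "edge \<Rightarrow> triangle" where
  "side1 (Hor, a, b) = (False, a, b)"
| "side1 (Ver, a, b) = (True, a, b)"
| "side1 (Dia, a, b) = (False, a, b)"

fun side2 :: "edge \<Rightarrow> triangle" where
  "side2 (Hor, a, b) = (True, a, b - 1)"
| "side2 (Ver, a, b) = (False, a - 1, b)"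
| "side2 (Dia, a, b) = (True, a, b)"

text \<open>The boundary map modulo 2 on sets of triangles, with \<open>sym_diff\<close> as
  addition.\<close>

definition bd :: "triangle set \<Rightarrow> edge set" where
  "bd A = {e. (side1 e \<in> A) \<noteq> (side2 e \<in> A)}"

text \<open>The boundary map modulo 2 on sets of edges: \<open>odd_points Z = {}\<close> says that
  \<open>Z\<close> is a cycle.\<close>

definition odd_points :: "edge set \<Rightarrow> point set" where
  "odd_points Z = {p. odd (card {e \<in> Z. p \<in> ends e})}"

lemma bd_sym_diff: "bd (sym_diff A B) = sym_diff (bd A) (bd B)"
  by (auto simp: bd_def)

lemma ends_inject: "ends e = ends f \<Longrightarrow> e = f"
proof -
  assume a: "ends e = ends f"
  obtain k a b where e: "e = (k, a, b)" by (metis surj_pair)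
  obtain l c d where f: "f = (l, c, d)" by (metis surj_pair)
  show ?thesis using a unfolding e f by (cases k; cases l) (auto simp: doubleton_eq_iff)
qed

lemma ends_subset_corners_iff: "ends e \<subseteq> corners t \<longleftrightarrow> t = side1 e \<or> t = side2 e"
proof -
  obtain k a b where e: "e = (k, a, b)" by (metis surj_pair)
  obtain l c d where t: "t = (l, c, d)" by (metis surj_pair)
  show ?thesis unfolding e t by (cases k; cases l) auto
qed

lemma edge_set_eqI: "(\<And>k a b. (k, a, b) \<in> X \<longleftrightarrow> (k, a, b) \<in> Y) \<Longrightarrow> X = (Y :: edge set)"
  by (simp only: set_eq_iff split_paired_All) blast

lemma triangle_edges:
  obtains p q r e f g where "corners t = {p, q, r}" "ends e = {p, q}" "ends f = {p, r}" "ends g = {q, r}"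
    "p \<noteq> q" "p \<noteq> r" "q \<noteq> r" "{e'. side1 e' = t \<or> side2 e' = t} = {e, f, g}"
proof -
  obtain l a b where t: "t = (l, a, b)" by (metis surj_pair)
  show ?thesis
  proof (cases l)
    case True
    have "{e'. side1 e' = t \<or> side2 e' = t} = {(Ver, a, b), (Dia, a, b), (Hor, a, b + 1)}"
      by (rule edge_set_eqI, rename_tac k c d, case_tac k) (auto simp: t True)
    then show ?thesis
      by (intro that[of "(a, b)" "(a, b + 1)" "(a + 1, b + 1)" "(Ver, a, b)" "(Dia, a, b)"
          "(Hor, a, b + 1)"])
        (simp_all add: t True)
  next
    case False
    have "{e'. side1 e' = t \<or> side2 e' = t} = {(Hor, a, b), (Dia, a, b), (Ver, a + 1, b)}"
      by (rule edge_set_eqI, rename_tac k c d, case_tac k) (auto simp: t False)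
    then show ?thesis
      by (intro that[of "(a, b)" "(a + 1, b)" "(a + 1, b + 1)" "(Hor, a, b)" "(Dia, a, b)"
          "(Ver, a + 1, b)"])
        (simp_all add: t False)
  qed
qed

lemma third_corner:
  assumes "t = side1 e \<or> t = side2 e" and "ends e = {x, y}"
  obtains z f g where "corners t = {x, y, z}" "ends f = {x, z}" "ends g = {y, z}" "z \<noteq> x" "z \<noteq> y"
    "x \<noteq> y" "{e'. side1 e' = t \<or> side2 e' = t} = {e, f, g}"
proof -
  obtain p q r e1 e2 e3 where *: "corners t = {p, q, r}" "ends e1 = {p, q}" "ends e2 = {p, r}"
      "ends e3 = {q, r}"
    "p \<noteq> q" "p \<noteq> r" "q \<noteq> r" and **: "{e'. side1 e' = t \<or> side2 e' = t} = {e1, e2, e3}"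
    by (rule triangle_edges)
  have "e \<in> {e1, e2, e3}" using ** assms(1) by blast
  then consider "e = e1" | "e = e2" | "e = e3" by blast
  then show ?thesis
  proof cases
    case 1
    then consider "x = p" "y = q" | "x = q" "y = p" using * assms(2) by (metis doubleton_eq_iff)
    then show ?thesis
    proof cases
      case 1
      show ?thesis by (rule that[of r e2 e3]) (use * ** \<open>e = e1\<close> 1 in \<open>auto simp: insert_commute\<close>)
    next
      case 2
      show ?thesis by (rule that[of r e3 e2]) (use * ** \<open>e = e1\<close> 2 in \<open>auto simp: insert_commute\<close>)
    qed
  next
    case 2
    then consider "x = p" "y = r" | "x = r" "y = p" using * assms(2) by (metis doubleton_eq_iff)
    then show ?thesis
    proof cases
      case 1
      show ?thesis by (rule that[of q e1 e3]) (use * ** \<open>e = e2\<close> 1 in \<open>auto simp: insert_commute\<close>)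
    next
      case 2
      show ?thesis by (rule that[of q e3 e1]) (use * ** \<open>e = e2\<close> 2 in \<open>auto simp: insert_commute\<close>)
    qed
  next
    case 3
    then consider "x = q" "y = r" | "x = r" "y = q" using * assms(2) by (metis doubleton_eq_iff)
    then show ?thesis
    proof cases
      case 1
      show ?thesis by (rule that[of p e1 e2]) (use * ** \<open>e = e3\<close> 1 in \<open>auto simp: insert_commute\<close>)
    next
      case 2
      show ?thesis by (rule that[of p e2 e1]) (use * ** \<open>e = e3\<close> 2 in \<open>auto simp: insert_commute\<close>)
    qed
  qed
qed

text \<open>The six triangles at \<open>p\<close> form a ring in which neighbours share an edge at
  \<open>p\<close>. No such edge separates \<open>A\<close> from its complement, so membership in
  \<open>A\<close> is constant on the ring.\<close>

lemma link_connected: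
  assumes "p \<in> corners t" "p \<in> corners t'" and "\<And>e. p \<in> ends e \<Longrightarrow> e \<notin> bd A"
  shows "t \<in> A \<longleftrightarrow> t' \<in> A"
proof -
  obtain a b where p: "p = (a, b)" by (cases p)
  have e: "(side1 (k, c, d) \<in> A) = (side2 (k, c, d) \<in> A)" if "p \<in> ends (k, c, d)" for k c d
    using assms(3)[OF that] by (auto simp: bd_def)
  have "(t \<in> A) = ((False, a, b) \<in> A)" if "p \<in> corners t" for t
  proof -
    obtain l c d where t: "t = (l, c, d)" by (metis surj_pair)
    have *: "t \<in> {(False, a, b), (False, a - 1, b), (False, a - 1, b - 1), (True, a, b), (True, a,
        b - 1),
      (True, a - 1, b - 1)}"
      using that unfolding t p by (cases l) auto
    show ?thesis
      using e[of Hor a b] e[of Hor "a - 1" b] e[of Ver a b] e[of Ver a "b - 1"] e[of Dia a b]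
        e[of Dia "a - 1" "b - 1"] * unfolding p by auto
  qed
  then show ?thesis using assms by blast
qed

section \<open>Parity of degrees, and filling a cycle with triangles\<close>

lemma odd_card_inter_insert:
  assumes "finite F" "x \<notin> F"
  shows "odd (card (Z \<inter> insert x F)) \<longleftrightarrow> (x \<in> Z) \<noteq> odd (card (Z \<inter> F))"
  using assms by (cases "x \<in> Z") auto

lemma odd_card_sym_diff:
  assumes "finite A" "finite B"
  shows "odd (card (sym_diff A B)) \<longleftrightarrow> odd (card A) \<noteq> odd (card B)"
proof -
  have "card (sym_diff A B) = card (A - B) + card (B - A)"
    using assms by (intro card_Un_disjoint) auto
  moreover have "card A = card (A - B) + card (A \<inter> B)" "card B = card (B - A) + card (A \<inter> B)"
    using assms card_Int_Diff[of A B] card_Int_Diff[of B A] by (simp_all add: Int_commute)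
  ultimately show ?thesis by presburger
qed

lemma odd_points_sym_diff:
  assumes "finite A" "finite B"
  shows "odd_points (sym_diff A B) = sym_diff (odd_points A) (odd_points B)"
proof -
  have "{e \<in> sym_diff A B. p \<in> ends e} = sym_diff {e \<in> A. p \<in> ends e} {e \<in> B. p \<in> ends e}" for p
    by auto
  then have "odd (card {e \<in> sym_diff A B. p \<in> ends e}) \<longleftrightarrow>
      odd (card {e \<in> A. p \<in> ends e}) \<noteq> odd (card {e \<in> B. p \<in> ends e})" for p
    using odd_card_sym_diff[of "{e \<in> A. p \<in> ends e}" "{e \<in> B. p \<in> ends e}"] assms by simp
  then show ?thesis by (auto simp: odd_points_def)
qed

text \<open>Without boundary edges \<open>A\<close> cannot be left by walking to the left, so it
  would contain infinitely many triangles of a row. This yields the uniqueness of the filling of a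
  cycle.\<close>

lemma bd_empty_imp_empty:
  assumes "finite A" "bd A = {}"
  shows "A = {}"
proof (rule ccontr)
  assume "A \<noteq> {}"
  then obtain l a b where "(l, a, b) \<in> A" by (metis surj_pair ex_in_conv)
  have e: "(side1 (k, c, d) \<in> A) = (side2 (k, c, d) \<in> A)" for k c d
    using assms(2) by (auto simp: bd_def)
  have 0: "(False, a, b) \<in> A" using \<open>(l, a, b) \<in> A\<close> e[of Dia a b] by (cases l) auto
  have "(False, a - int n, b) \<in> A" for n
  proof (induction n)
    case 0
    then show ?case using \<open>(False, a, b) \<in> A\<close> by simp
  next
    case (Suc n)
    then show ?case using e[of Dia "a - int n" b] e[of Ver "a - int n" b] by (simp add: algebra_simps)
  qed
  then have "range (\<lambda>n. (False, a - int n, b)) \<subseteq> A" by blast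
  moreover have "infinite (range (\<lambda>n. (False, a - int n, b)))"
    by (rule range_inj_infinite) (auto simp: inj_def)
  ultimately show False using assms(1) finite_subset by blast
qed

text \<open>A triangle is enclosed if the number of edges of the cycle to its right in its own row is odd.\<close>

lemma fill_cycle:
  assumes "finite Z" "odd_points Z = {}"
  obtains A where "finite A" "bd A = Z"
proof -
  \<comment> \<open>\<open>R a b\<close> contains the edges to the right of the lower triangle
    \<open>(False, a, b)\<close>. The upper triangle \<open>(True, a, b)\<close> also has the
    diagonal \<open>(Dia, a, b)\<close> to its right, hence the extra term in
    \<open>A\<close>.\<close>
  define R where "R a b = {e. \<exists>c>a. e = (Ver, c, b) \<or> e = (Dia, c, b)}" for a b :: int
  define lo where "lo a b = odd (card (Z \<inter> R a b))" for a b
  define A where "A = {t. \<exists>a b. t = (False, a, b) \<and> lo a b \<or> t = (True, a, b) \<and> (lo a b \<noteq> ((Dia, a,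
      b) \<in> Z))}"
  have mem: "(False, a, b) \<in> A \<longleftrightarrow> lo a b" "(True, a, b) \<in> A \<longleftrightarrow> (lo a b \<noteq> ((Dia, a, b) \<in> Z))" for a b
    by (auto simp: A_def)
  have R: "R (a - 1) b = insert (Ver, a, b) (insert (Dia, a, b) (R a b))" for a b
    by (rule edge_set_eqI) (auto simp: R_def)
  have lo: "lo (a - 1) b \<longleftrightarrow> (((Ver, a, b) \<in> Z) \<noteq> (((Dia, a, b) \<in> Z) \<noteq> lo a b))" for a b
  proof -
    have *: "odd (card (Z \<inter> insert x F)) \<longleftrightarrow> (x \<in> Z) \<noteq> odd (card (Z \<inter> F))" if "x \<notin> F" for x F
      using that assms(1) by (cases "x \<in> Z") (simp_all add: Int_insert_right)
    have "(Ver, a, b) \<notin> insert (Dia, a, b) (R a b)" "(Dia, a, b) \<notin> R a b" by (simp_all add: R_def)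
    then show ?thesis unfolding lo_def R by (simp only: * simp_thms)
  qed
  \<comment> \<open>The even degree of \<open>(a, b)\<close>, written out for the six edges
    there.\<close>
  have cyc: "((Hor, a, b) \<in> Z) = (((Hor, a - 1, b) \<in> Z) \<noteq> (((Ver, a, b) \<in> Z) \<noteq> (((Ver, a, b - 1) \<in> Z) \<noteq>
     (((Dia, a, b) \<in> Z) \<noteq> ((Dia, a - 1, b - 1) \<in> Z)))))" for a b
  proof -
    have "{e \<in> Z. (a, b) \<in> ends e} = Z \<inter> {(Hor, a, b), (Hor, a - 1, b), (Ver, a, b), (Ver, a,
        b - 1), (Dia, a, b), (Dia, a - 1, b - 1)}"
    proof -
      have *: "(a, b) \<in> ends (k, c, d) \<longleftrightarrow> (k, c, d) \<in> {(Hor, a, b), (Hor, a - 1, b), (Ver, a, b),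
          (Ver, a, b - 1), (Dia, a, b), (Dia, a - 1, b - 1)}" for k c d
        by (cases k) auto
      show ?thesis by (rule edge_set_eqI) (simp only: mem_Collect_eq Int_iff *)
    qed
    moreover have "\<not> odd (card {e \<in> Z. (a, b) \<in> ends e})" using assms(2) by (auto simp: odd_points_def)
    ultimately have "\<not> odd (card (Z \<inter> {(Hor, a, b), (Hor, a - 1, b), (Ver, a, b), (Ver, a, b - 1),
        (Dia, a, b), (Dia, a - 1, b - 1)}))"
      by simp
    moreover have "odd (card (Z \<inter> {(Hor, a, b), (Hor, a - 1, b), (Ver, a, b), (Ver, a, b - 1), (Dia,
        a, b), (Dia, a - 1, b - 1)})) =
      (((Hor, a, b) \<in> Z) \<noteq> (((Hor, a - 1, b) \<in> Z) \<noteq> (((Ver, a, b) \<in> Z) \<noteq> (((Ver, a, b - 1) \<in> Z) \<noteq>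
     (((Dia, a, b) \<in> Z) \<noteq> ((Dia, a - 1, b - 1) \<in> Z))))))"
      by (subst odd_card_inter_insert, simp, simp)+ simp
    ultimately show ?thesis by fast
  qed
  obtain M where M: "\<And>k a b. (k, a, b) \<in> Z \<Longrightarrow> \<bar>a\<bar> < M \<and> \<bar>b\<bar> < M"
  proof -
    have "finite ((\<lambda>(k, a, b). max \<bar>a\<bar> \<bar>b\<bar>) ` Z)" using assms(1) by simp
    then have "bdd_above ((\<lambda>(k, a, b). max \<bar>a\<bar> \<bar>b\<bar>) ` Z)" by simp
    then obtain M where "\<forall>x\<in>(\<lambda>(k, a, b). max \<bar>a\<bar> \<bar>b\<bar>) ` Z. x \<le> M" by (auto simp: bdd_above_def)
    then show ?thesis by (intro that[of "M + 1"]) force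
  qed
  \<comment> \<open>Rows are compared here, whereas \<open>lo\<close> only looks along one row. Far
    to the right all terms are false; on moving one column to the left both sides change alike,
    because the point \<open>(a, b)\<close> that is passed has even degree.\<close>
  have hor: "(lo a b \<noteq> (lo a (b - 1) \<noteq> ((Dia, a, b - 1) \<in> Z))) = ((Hor, a, b) \<in> Z)" (is "?P a") for a b
  proof -
    have big: "?P a" if "a \<ge> M" for a
    proof -
      have "Z \<inter> R a c = {}" for c using M that by (force simp: R_def)
      then show ?thesis using M[of _ a] that by (force simp: lo_def)
    qed
    have stp: "?P (a - 1)" if "?P a" for a
      using that cyc[of a b] lo[of a b] lo[of a "b - 1"] by (smt (verit))
    have "?P (max M a - int n)" for n
    proof (induction n)
      case 0
      then show ?case using big by simp
    next
      case (Suc n)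
      then show ?case using stp[of "max M a - int n"] by (simp add: algebra_simps)
    qed
    from this[of "nat (max M a - a)"] show ?thesis by simp
  qed
  have "bd A = Z"
  proof -
    have "(k, a, b) \<in> bd A \<longleftrightarrow> (k, a, b) \<in> Z" for k a b
      using hor[of a b] lo[of a b] by (cases k) (auto simp: bd_def mem)
    then show ?thesis by (rule edge_set_eqI)
  qed
  moreover have "finite A"
  proof (rule finite_subset)
    show "A \<subseteq> UNIV \<times> {-M..M} \<times> {-M..M}"
    proof
      fix t assume "t \<in> A"
      obtain l a b where t: "t = (l, a, b)" by (metis surj_pair)
      have nb: "\<bar>b\<bar> < M"
      proof (rule ccontr)
        assume "\<not> \<bar>b\<bar> < M"
        then have "(k, c, b) \<notin> Z" for k c using M by blast
        then have "Z \<inter> R a b = {}" "(Dia, a, b) \<notin> Z" by (auto simp: R_def)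
        then show False using \<open>t \<in> A\<close> by (cases l) (auto simp: t mem lo_def)
      qed
      have "a \<le> M"
      proof (rule ccontr)
        assume "\<not> a \<le> M"
        then have "Z \<inter> R a b = {}" "(Dia, a, b) \<notin> Z" using M by (force simp: R_def)+
        then show False using \<open>t \<in> A\<close> by (cases l) (auto simp: t mem lo_def)
      qed
      \<comment> \<open>To the left of all edges the parity is the same in every row, and in row
        \<open>- M\<close> there are no edges at all.\<close>
      moreover have "- M \<le> a"
      proof (rule ccontr)
        assume a: "\<not> - M \<le> a"
        then have Z: "(k, a, c) \<notin> Z" for k c using M[of k a c] by auto
        then have down: "lo a c = lo a (c - 1)" for c using hor[of a c] by auto
        have "lo a b = lo a (b - int n)" for n
        proof (induction n)
          case (Suc n)
          have "b - int (Suc n) = b - int n - 1" by simp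
          then show ?case using Suc.IH down[of "b - int n"] by (simp only:)
        qed simp
        moreover have "b - int (nat (b + M)) = - M" using nb by simp
        ultimately have "lo a b = lo a (- M)" by metis
        moreover have "Z \<inter> R a (- M) = {}" using M[of _ _ "- M"] by (fastforce simp: R_def)
        then have "\<not> lo a (- M)" by (simp add: lo_def)
        ultimately show False using \<open>t \<in> A\<close> Z by (cases l) (auto simp: t mem)
      qed
      ultimately show "t \<in> UNIV \<times> {-M..M} \<times> {-M..M}" using nb by (auto simp: t)
    qed
  qed simp
  ultimately show ?thesis using that by blast
qed

section \<open>Trees and fundamental cycles in the lattice\<close>

definition adj :: "point \<Rightarrow> point \<Rightarrow> bool" where
  "adj p q \<longleftrightarrow> (\<exists>e. ends e = {p, q})"

text \<open>\<open>rk\<close> rules out cycles of parents; any function that decreases towards the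
  root will do.\<close>

definition tree :: "point set \<Rightarrow> point \<Rightarrow> (point \<Rightarrow> point) \<Rightarrow> (point \<Rightarrow> nat) \<Rightarrow> bool" where
  "tree T r par rk \<longleftrightarrow> finite T \<and> r \<in> T \<and> (\<forall>c\<in>T - {r}. par c \<in> T \<and> adj c (par c) \<and> rk (par c) < rk c)"

definition tree_edges :: "point set \<Rightarrow> point \<Rightarrow> (point \<Rightarrow> point) \<Rightarrow> edge set" where
  "tree_edges T r par = {e. \<exists>c\<in>T - {r}. ends e = {c, par c}}"

text \<open>The points of the path from \<open>x\<close> up to the root. The condition
  \<open>c \<noteq> r\<close> stops the climb at \<open>r\<close>, where \<open>par\<close> is
  arbitrary.\<close>

inductive_set anc :: "(point \<Rightarrow> point) \<Rightarrow> point \<Rightarrow> point \<Rightarrow> point set" for par r x where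
  self: "x \<in> anc par r x"
| up: "c \<in> anc par r x \<Longrightarrow> c \<noteq> r \<Longrightarrow> par c \<in> anc par r x"

lemma adj_sym: "adj p q \<Longrightarrow> adj q p"
  by (auto simp: adj_def insert_commute)

lemma adj_neq: "adj p q \<Longrightarrow> p \<noteq> q"
proof
  assume "adj p q" "p = q"
  then obtain e where e: "ends e = {p}" by (auto simp: adj_def)
  obtain k a b where "e = (k, a, b)" by (metis surj_pair)
  then show False using e by (cases k) auto
qed

lemma tree_par:
  assumes "tree T r par rk" "c \<in> T" "c \<noteq> r"
  shows "par c \<in> T" "adj c (par c)" "rk (par c) < rk c"
  using assms by (auto simp: tree_def)

lemma anc_root: "anc par r r = {r}"
proof -
  have "c = r" if "c \<in> anc par r r" for c using that by induction auto
  then show ?thesis using anc.self by blast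
qed

lemma anc_step:
  assumes "x \<noteq> r"
  shows "anc par r x = insert x (anc par r (par x))"
proof -
  have "c \<in> insert x (anc par r (par x))" if "c \<in> anc par r x" for c
    using that by induction (auto intro: anc.intros)
  moreover have "c \<in> anc par r x" if "c \<in> anc par r (par x)" for c
    using that assms by induction (auto intro: anc.intros)
  ultimately show ?thesis using anc.self by blast
qed

lemma anc_subset:
  assumes "tree T r par rk" "x \<in> T"
  shows "anc par r x \<subseteq> T"
proof
  fix c assume "c \<in> anc par r x"
  then show "c \<in> T" using assms by induction (auto dest: tree_par)
qed

lemma anc_rank_le:
  assumes "tree T r par rk" "x \<in> T" "c \<in> anc par r x"
  shows "rk c \<le> rk x"
  using assms(3)
proof induction
  case (up c)
  then have "c \<in> T" using anc_subset assms by blast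
  then show ?case using up tree_par[OF assms(1)] by fastforce
qed simp

lemma root_in_anc:
  assumes "tree T r par rk" "x \<in> T"
  shows "r \<in> anc par r x"
  using assms(2)
proof (induction "rk x" arbitrary: x rule: less_induct)
  case less
  show ?case
  proof (cases "x = r")
    case False
    then show ?thesis using less tree_par[OF assms(1) less.prems False] anc_step[OF False] by blast
  qed (auto intro: anc.self)
qed

lemma finite_tree_edges:
  assumes "tree T r par rk"
  shows "finite (tree_edges T r par)"
proof -
  have "inj ends" by (auto intro: injI ends_inject)
  then have "finite (ends -` ((\<lambda>c. {c, par c}) ` T))"
    using assms by (intro finite_vimageI) (auto simp: tree_def)
  then show ?thesis by (rule rev_finite_subset) (auto simp: tree_edges_def)
qed

text \<open>Among the lower ends of the edges of \<open>Z\<close>, one of greatest rank is a leaf of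
  \<open>Z\<close>: an edge to a child of it would have a lower end of greater rank. Its degree is
  one, hence odd.\<close>

lemma tree_edges_acyclic:
  assumes T: "tree T r par rk" and Z: "Z \<subseteq> tree_edges T r par" "odd_points Z = {}"
  shows "Z = {}"
proof (rule ccontr)
  assume ne: "Z \<noteq> {}"
  define C where "C = {c \<in> T - {r}. \<exists>e\<in>Z. ends e = {c, par c}}"
  have "finite C" using T by (simp add: C_def tree_def)
  obtain e where "e \<in> Z" using ne by blast
  then have "C \<noteq> {}" using Z(1) by (fastforce simp: C_def tree_edges_def)
  then have "Max (rk ` C) \<in> rk ` C" using \<open>finite C\<close> by simp
  then obtain c where c: "c \<in> C" "Max (rk ` C) = rk c" by blast
  have max: "rk d \<le> rk c" if "d \<in> C" for d
    unfolding c(2)[symmetric] using that \<open>finite C\<close> by simp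
  from c(1) obtain e where e: "e \<in> Z" "ends e = {c, par c}" by (auto simp: C_def)
  have "{e' \<in> Z. c \<in> ends e'} = {e}"
  proof -
    have "e' = e" if e': "e' \<in> Z" "c \<in> ends e'" for e'
    proof -
      obtain d where d: "d \<in> T - {r}" "ends e' = {d, par d}" 
        using subsetD[OF Z(1) e'(1)] unfolding tree_edges_def by blast
      then have "d \<in> C" using e' by (auto simp: C_def)
      have "d = c"
      proof (rule ccontr)
        assume "d \<noteq> c"
        then have "par d = c" using e' d by auto
        then show False using max[OF \<open>d \<in> C\<close>] tree_par(3)[OF T] d by fastforce
      qed
      then show ?thesis using d e by (intro ends_inject) simp
    qed
    then have "{e' \<in> Z. c \<in> ends e'} \<subseteq> {e}" by blast
    moreover have "e \<in> {e' \<in> Z. c \<in> ends e'}" using e by simp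
    ultimately show ?thesis by blast
  qed
  then have "c \<in> odd_points Z" by (simp add: odd_points_def)
  then show False using Z(2) by simp
qed

section \<open>Fundamental cycles\<close>

definition path_edges :: "(point \<Rightarrow> point) \<Rightarrow> point \<Rightarrow> point \<Rightarrow> edge set" where
  "path_edges par r x = {e. \<exists>c\<in>anc par r x - {r}. ends e = {c, par c}}"

lemma path_edges_subset:
  assumes "tree T r par rk" "x \<in> T"
  shows "path_edges par r x \<subseteq> tree_edges T r par"
  using anc_subset[OF assms] by (auto simp: path_edges_def tree_edges_def)

lemma odd_points_singleton: "odd_points {e} = ends e"
proof -
  have "{e' \<in> {e}. p \<in> ends e'} = (if p \<in> ends e then {e} else {})" for p by auto
  then show ?thesis by (auto simp: odd_points_def)
qed

lemma odd_points_path_edges: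
  assumes T: "tree T r par rk" and "x \<in> T"
  shows "odd_points (path_edges par r x) = (if x = r then {} else {x, r})"
  using assms(2)
proof (induction "rk x" arbitrary: x rule: less_induct)
  case less
  show ?case
  proof (cases "x = r")
    case True
    then show ?thesis by (auto simp: path_edges_def anc_root odd_points_def)
  next
    case False
    note p = tree_par[OF T less.prems False]
    obtain e where e: "ends e = {x, par x}" using p by (auto simp: adj_def)
    have x: "x \<notin> anc par r (par x)" using anc_rank_le[OF T p(1), of x] p(3) by auto
    have "e \<notin> path_edges par r (par x)"
    proof
      assume "e \<in> path_edges par r (par x)"
      then obtain c where c: "c \<in> anc par r (par x)" "c \<noteq> r" "{c, par c} = {x, par x}"
        using e by (auto simp: path_edges_def)
      then have "par c = x" using x by (metis doubleton_eq_iff)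
      then have "x \<in> anc par r (par x)" using c anc.up by metis
      then show False using x by simp
    qed
    moreover have "path_edges par r x = insert e (path_edges par r (par x))"
    proof -
      have "path_edges par r x = {e'. ends e' = {x, par x}} \<union> path_edges par r (par x)"
        using False by (auto simp: path_edges_def anc_step[OF False])
      moreover have "e' = e" if "ends e' = {x, par x}" for e' using that e by (intro ends_inject) simp
      then have "{e'. ends e' = {x, par x}} = {e}" using e by blast
      ultimately show ?thesis by simp
    qed
    ultimately have "path_edges par r x = sym_diff {e} (path_edges par r (par x))" by auto
    then have "odd_points (path_edges par r x) = sym_diff {x,
        par x} (odd_points (path_edges par r (par x)))"
      using finite_subset[OF path_edges_subset[OF T p(1)] finite_tree_edges[OF T]]
      by (simp only: odd_points_sym_diff[OF finite.emptyI[THEN finite.insertI]] odd_points_singleton e)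
    then show ?thesis using less.hyps[OF p(3,1)] False adj_neq[OF p(2)] by auto
  qed
qed

text \<open>The common part of the two tree paths cancels. If \<open>e\<close> is itself a tree
  edge, it cancels as well and nothing remains.\<close>

definition fund_cycle :: "(point \<Rightarrow> point) \<Rightarrow> point \<Rightarrow> point \<Rightarrow> point \<Rightarrow> edge \<Rightarrow> edge set" where
  "fund_cycle par r x y e = sym_diff (sym_diff (path_edges par r x) (path_edges par r y)) {e}"

lemma fund_cycle_subset:
  assumes "tree T r par rk" "x \<in> T" "y \<in> T"
  shows "fund_cycle par r x y e \<subseteq> insert e (tree_edges T r par)"
  using path_edges_subset[OF assms(1,2)] path_edges_subset[OF assms(1,3)] by (auto simp: fund_cycle_def)

lemma finite_fund_cycle:
  assumes "tree T r par rk" "x \<in> T" "y \<in> T"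
  shows "finite (fund_cycle par r x y e)"
  using finite_subset[OF fund_cycle_subset[OF assms]] finite_tree_edges[OF assms(1)] by simp

lemma odd_points_fund_cycle:
  assumes "tree T r par rk" "x \<in> T" "y \<in> T" "ends e = {x, y}"
  shows "odd_points (fund_cycle par r x y e) = {}"
proof -
  have "x \<noteq> y" using assms(4) adj_neq adj_def by blast
  have fin: "finite (path_edges par r x)" "finite (path_edges par r y)"
    using finite_subset[OF path_edges_subset finite_tree_edges] assms by blast+
  have "odd_points (fund_cycle par r x y e) =
      sym_diff (sym_diff (odd_points (path_edges par r x)) (odd_points (path_edges par r y))) {x, y}"
    unfolding fund_cycle_def using fin by (subst odd_points_sym_diff odd_points_singleton, simp,
        simp)+ (simp add: odd_points_singleton assms(4))
  then show ?thesis
    using \<open>x \<noteq> y\<close> by (auto simp: odd_points_path_edges[OF assms(1)] assms(2,3) split: if_splits)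
qed

text \<open>The sum of the two cycles no longer contains \<open>e\<close>, so it is a cycle in the
  tree and therefore empty.\<close>

lemma cycle_eq_fund_cycle:
  assumes T: "tree T r par rk" and "x \<in> T" "y \<in> T" "ends e = {x, y}"
    and Z: "Z \<subseteq> insert e (tree_edges T r par)" "odd_points Z = {}" "e \<in> Z" "e \<notin> tree_edges T r par"
  shows "Z = fund_cycle par r x y e"
proof -
  let ?F = "fund_cycle par r x y e"
  have "e \<in> ?F" using Z(4) path_edges_subset[OF T assms(2)] path_edges_subset[OF T assms(3)]
    by (auto simp: fund_cycle_def)
  then have "sym_diff Z ?F \<subseteq> tree_edges T r par"
    using Z fund_cycle_subset[OF T assms(2,3), of e] by auto
  moreover have "odd_points (sym_diff Z ?F) = {}"
    using Z(1,2) odd_points_sym_diff[of Z ?F] finite_fund_cycle[OF T assms(2,3), of e]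
      odd_points_fund_cycle[OF assms(1-4)] finite_subset[of Z] finite_tree_edges[OF T] by simp
  ultimately have "sym_diff Z ?F = {}" using tree_edges_acyclic[OF T] by blast
  then show ?thesis by blast
qed

section \<open>Boundaries of triangle sets and cutting a disc\<close>

lemma finite_bd:
  assumes "finite A"
  shows "finite (bd A)"
proof -
  have "finite {e. side1 e = t \<or> side2 e = t}" for t
    by (rule triangle_edges[of t]) simp
  then have "finite (\<Union>t\<in>A. {e. side1 e = t \<or> side2 e = t})" using assms by simp
  then show ?thesis by (rule rev_finite_subset) (auto simp: bd_def)
qed

lemma odd_points_bd:
  assumes "finite A"
  shows "odd_points (bd A) = {}"
  using assms
proof (induction A rule: finite_induct)
  case empty
  then show ?case by (auto simp: bd_def odd_points_def)
next
  case (insert t A)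
  obtain p q r e f g where t: "corners t = {p, q, r}" "ends e = {p, q}" "ends f = {p, r}"
      "ends g = {q, r}"
    "p \<noteq> q" "p \<noteq> r" "q \<noteq> r" "{e'. side1 e' = t \<or> side2 e' = t} = {e, f, g}"
    by (rule triangle_edges)
  have ne: "e \<noteq> f" "e \<noteq> g" "f \<noteq> g" using t by (auto simp: doubleton_eq_iff)
  have "side1 e' \<noteq> side2 e'" for e' by (cases e' rule: side1.cases) auto
  then have "bd {t} = {e, f, g}" unfolding t(8)[symmetric] by (auto simp: bd_def) metis
  also have "\<dots> = sym_diff (sym_diff {e} {f}) {g}" using ne by auto
  finally have "odd_points (bd {t}) = odd_points (sym_diff (sym_diff {e} {f}) {g})" by simp
  also have "\<dots> = sym_diff (sym_diff {p, q} {p, r}) {q, r}"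
    by (subst odd_points_sym_diff, simp, simp)+ (simp only: odd_points_singleton t)
  also have "\<dots> = {}" using t by auto
  finally have "odd_points (bd {t}) = {}" .
  moreover have "bd (insert t A) = sym_diff (bd {t}) (bd A)"
    using insert.hyps bd_sym_diff[of "{t}" A] by (simp add: insert_Diff_if)
  ultimately show ?case using insert finite_bd[of A] finite_bd[of "{t}"]
      by (simp add: odd_points_sym_diff)
qed

lemma fund_cycle_tree_edge:
  assumes T: "tree T r par rk" and "x \<in> T" "y \<in> T" "ends e = {x, y}" "e \<in> tree_edges T r par"
  shows "fund_cycle par r x y e = {}"
  using tree_edges_acyclic[OF T _ odd_points_fund_cycle[OF assms(1-4)]] fund_cycle_subset[OF
      assms(1-3), of e] assms(5)
  by (simp add: insert_absorb)

text \<open>The Jordan curve theorem, in the form needed: a third path through the triangle \<open>t\<close> cuts the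
  disc \<open>A\<close> enclosed by the fundamental cycle of \<open>xy\<close>.\<close>

lemma theta_split:
  assumes T: "tree T r par rk" and xyz: "x \<in> T" "y \<in> T" "z \<in> T"
    and e: "ends e = {x, y}" "ends f = {x, z}" "ends g = {y, z}" and "z \<noteq> x" "z \<noteq> y" "x \<noteq> y"
    and t: "{e'. side1 e' = t \<or> side2 e' = t} = {e, f, g}"
    and A: "finite A" "bd A = fund_cycle par r x y e" "t \<in> A"
  obtains B C where "finite B" "finite C" "bd B = fund_cycle par r x z f" "bd C = fund_cycle par r y z g"
    "A - {t} = B \<union> C" "B \<inter> C = {}" "t \<notin> B" "t \<notin> C"
proof -
  let ?E = "tree_edges T r par"
  have ne: "e \<noteq> f" "e \<noteq> g" "f \<noteq> g" using e assms(8-10) by (auto simp: doubleton_eq_iff)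
  obtain B where B: "finite B" "bd B = fund_cycle par r x z f"
    using fill_cycle[OF finite_fund_cycle odd_points_fund_cycle] T xyz e by metis
  obtain C where C: "finite C" "bd C = fund_cycle par r y z g"
    using fill_cycle[OF finite_fund_cycle odd_points_fund_cycle] T xyz e by metis
  have sides: "side1 e' \<noteq> side2 e'" for e' by (cases e' rule: side1.cases) auto
  then have bt: "bd {t} = {e, f, g}" unfolding t[symmetric] by (auto simp: bd_def) metis
  have eE: "e \<notin> ?E"
  proof
    assume "e \<in> ?E"
    then have "bd A = {}" using A fund_cycle_tree_edge[OF T xyz(1,2) e(1)] by simp
    then show False using bd_empty_imp_empty[OF A(1)] A(3) by simp
  qed
  \<comment> \<open>In the sum of the four boundaries every tree path occurs twice, and the three
    sides of \<open>t\<close> cancel. By uniqueness of fillings, \<open>A\<close> is the sum of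
    \<open>{t}\<close>, \<open>B\<close> and \<open>C\<close> modulo 2.\<close>
  have "bd (sym_diff (sym_diff A {t}) (sym_diff B C)) = {}"
    unfolding bd_sym_diff A B C bt fund_cycle_def using ne by auto
  then have "sym_diff (sym_diff A {t}) (sym_diff B C) = {}" using A B C
      by (intro bd_empty_imp_empty) auto
  then have split: "a \<in> A \<longleftrightarrow> ((a = t) \<noteq> ((a \<in> B) \<noteq> (a \<in> C)))" for a by auto
  have B_sub: "bd B \<subseteq> insert f ?E" and C_sub: "bd C \<subseteq> insert g ?E"
    using B C fund_cycle_subset[OF T] xyz by auto
  have empty: "D = {}" if "finite D" "bd D \<subseteq> ?E" for D
    using bd_empty_imp_empty[OF that(1) tree_edges_acyclic[OF T that(2) odd_points_bd[OF that(1)]]] .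
  have disj: "B \<inter> C = {} \<and> t \<notin> B \<and> t \<notin> C"
  proof (cases "f \<in> ?E \<or> g \<in> ?E")
    case True
    then have "B = {} \<or> C = {}" using empty[OF B(1)] empty[OF C(1)] B_sub C_sub
        by (auto simp: insert_absorb)
    then show ?thesis using split[of t] A(3) by auto
  next
    case False
    \<comment> \<open>The identity modulo 2 still allows \<open>B\<close> and \<open>C\<close> to
      overlap. The boundary of the overlap away from \<open>t\<close> lies in the tree together with
      \<open>e\<close>; hence the overlap is empty or equal to \<open>A\<close>, and the latter
      contains \<open>t\<close>.\<close>
    let ?D = "B \<inter> C - {t}"
    have other: "\<exists>s. {side1 e', side2 e'} = {t, s} \<and> s \<noteq> t" if "e' \<in> {e, f, g}" for e'
    proof -
      have "side1 e' = t \<or> side2 e' = t" using that t by blast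
      then show ?thesis using sides[of e'] by (metis insert_commute)
    qed
    have bdD: "bd ?D \<subseteq> bd B \<union> bd C \<union> {e, f, g}"
      unfolding bt[symmetric] by (auto simp: bd_def)
    have tBC: "t \<in> B \<longleftrightarrow> t \<in> C" using split[of t] A(3) by blast
    have B_iff: "f \<in> bd B" "e \<notin> bd B" "g \<notin> bd B" and C_iff: "g \<in> bd C" "e \<notin> bd C" "f \<notin> bd C"
      using B_sub C_sub ne eE False path_edges_subset[OF T] xyz
      unfolding B C fund_cycle_def by blast+
    \<comment> \<open>Only \<open>B\<close> changes across \<open>f\<close>, while \<open>t\<close>
      is in both sets or in neither. So the triangle across \<open>f\<close> is in exactly one of
      them, hence not in the overlap.\<close>
    have fD: "f \<notin> bd ?D"
    proof -
      obtain s where s: "{side1 f, side2 f} = {t, s}" "s \<noteq> t" using other by blast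
      have "(t \<in> B) \<noteq> (s \<in> B)" "(t \<in> C) = (s \<in> C)"
        using B_iff C_iff s(1) by (auto simp: bd_def doubleton_eq_iff)
      then have "s \<notin> B \<inter> C" using tBC by blast
      then show ?thesis using s by (auto simp: bd_def doubleton_eq_iff)
    qed
    have gD: "g \<notin> bd ?D"
    proof -
      obtain s where s: "{side1 g, side2 g} = {t, s}" "s \<noteq> t" using other by blast
      have "(t \<in> C) \<noteq> (s \<in> C)" "(t \<in> B) = (s \<in> B)"
        using B_iff C_iff s(1) by (auto simp: bd_def doubleton_eq_iff)
      then have "s \<notin> B \<inter> C" using tBC by blast
      then show ?thesis using s by (auto simp: bd_def doubleton_eq_iff)
    qed
    have D_sub: "bd ?D \<subseteq> insert e ?E" using bdD B_sub C_sub fD gD by blast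
    have finD: "finite ?D" using B by simp
    have "e \<notin> bd ?D"
    proof
      assume "e \<in> bd ?D"
      then have "bd ?D = fund_cycle par r x y e"
        using cycle_eq_fund_cycle[OF T xyz(1,2) e(1) D_sub odd_points_bd[OF finD]] eE by blast
      then have "bd (sym_diff A ?D) = {}" unfolding bd_sym_diff A by blast
      then have "sym_diff A ?D = {}" using A finD by (intro bd_empty_imp_empty) auto
      then show False using A(3) by blast
    qed
    then have "?D = {}" using D_sub empty[OF finD] by blast
    \<comment> \<open>If \<open>t\<close> were in both sets, so would be the triangle across
      \<open>e\<close>, since \<open>e\<close> bounds neither of them.\<close>
    moreover have "t \<notin> B"
    proof
      assume "t \<in> B"
      then have tC: "t \<in> C" using tBC by blast
      have "B \<inter> C = {t}" using \<open>?D = {}\<close> \<open>t \<in> B\<close> tC by blast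
      moreover obtain s where s: "{side1 e, side2 e} = {t, s}" "s \<noteq> t" using other by blast
      moreover have "(t \<in> B) = (s \<in> B)" "(t \<in> C) = (s \<in> C)"
        using B_iff C_iff s(1) by (auto simp: bd_def doubleton_eq_iff)
      ultimately show False using \<open>t \<in> B\<close> tC by blast
    qed
    ultimately show ?thesis using tBC by blast
  qed
  then have "A - {t} = B \<union> C" using split by blast
  then show ?thesis using that[OF B(1) C(1) B(2) C(2)] disj by blast
qed

section \<open>Winning positions\<close>

text \<open>The cops are to move. The case \<open>r \<in> set C'\<close> is a capture by this very
  move, before the robber answers.\<close>

fun wins_within :: "'a pair_pre_digraph \<Rightarrow> nat \<Rightarrow> 'a list \<Rightarrow> 'a \<Rightarrow> bool" where
  "wins_within G 0 C r \<longleftrightarrow> r \<in> set C"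
| "wins_within G (Suc n) C r \<longleftrightarrow> r \<in> set C \<or>
    (\<exists>C'. list_all2 (step G) C C' \<and> (\<forall>r'. step G r r' \<longrightarrow> r \<in> set C' \<or> wins_within G n C' r'))"

definition winning :: "'a pair_pre_digraph \<Rightarrow> 'a list \<Rightarrow> 'a \<Rightarrow> bool" where
  "winning G C r \<longleftrightarrow> (\<exists>n. wins_within G n C r)"

lemma step_refl: "step G v v"
  by (simp add: step_def)

lemma wins_within_Suc: "wins_within G n C r \<Longrightarrow> wins_within G (Suc n) C r"
proof (induction n arbitrary: C r)
  case 0
  then show ?case by simp
next
  case (Suc n)
  show ?case
  proof (cases "r \<in> set C")
    case False
    then obtain C' where "list_all2 (step G) C C'"
      "\<And>r'. step G r r' \<Longrightarrow> r \<in> set C' \<or> wins_within G n C' r'"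
      using Suc.prems by (auto simp only: wins_within.simps)
    then show ?thesis unfolding wins_within.simps(2)[of G "Suc n"] using Suc.IH by blast
  qed simp
qed

lemma wins_within_mono: "m \<le> n \<Longrightarrow> wins_within G m C r \<Longrightarrow> wins_within G n C r"
  by (induction n rule: dec_induct) (simp_all only: wins_within_Suc)

text \<open>Positions are lists, but the cops are interchangeable; this lets the cops of a released
  path change their role.\<close>

lemma wins_within_mset:
  "wins_within G n C r \<Longrightarrow> mset C' = mset C \<Longrightarrow> wins_within G n C' r"
proof (induction n arbitrary: C C' r)
  case 0
  then show ?case by (metis mset_eq_setD wins_within.simps(1))
next
  case (Suc n)
  show ?case
  proof (cases "r \<in> set C")
    case True
    then show ?thesis using Suc.prems mset_eq_setD by fastforce
  next
    case False
    then obtain E where E: "list_all2 (step G) C E"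
      and r: "\<And>r'. step G r r' \<Longrightarrow> r \<in> set E \<or> wins_within G n E r'"
      using Suc.prems by auto
    obtain E' where E': "list_all2 (step G) C' E'" "mset E' = mset E"
      using list_all2_reorder_left_invariance[OF E Suc.prems(2)] by blast
    have "r \<in> set E' \<or> wins_within G n E' r'" if "step G r r'" for r'
      using r[OF that] Suc.IH E'(2) mset_eq_setD by metis
    then show ?thesis using E' by auto
  qed
qed

lemma winning_mset: "winning G C r \<Longrightarrow> mset C' = mset C \<Longrightarrow> winning G C' r"
  by (auto simp: winning_def intro: wins_within_mset)

text \<open>The robber has finitely many answers, so the numbers of rounds they require have a
  maximum.\<close>

lemma winning_move:
  assumes "finite (parcs G)" and "list_all2 (step G) C C'"
    and "\<And>r'. step G r r' \<Longrightarrow> r \<in> set C' \<or> winning G C' r'"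
  shows "winning G C r"
proof (cases "r \<in> set C'")
  case True
  then have "wins_within G 1 C r" using assms(2) by auto
  then show ?thesis unfolding winning_def by blast
next
  case False
  have "{r'. step G r r'} \<subseteq> insert r (snd ` parcs G)" by (force simp: step_def)
  then have fin: "finite {r'. step G r r'}" using assms(1) finite_subset by auto
  have "\<forall>r'. \<exists>n. step G r r' \<longrightarrow> wins_within G n C' r'"
    using assms(3) False by (auto simp: winning_def)
  then obtain N where N: "\<And>r'. step G r r' \<Longrightarrow> wins_within G (N r') C' r'" by metis
  have "wins_within G (Max (N ` {r'. step G r r'})) C' r'" if "step G r r'" for r'
    using N[OF that] fin that by (auto intro: wins_within_mono[rotated])
  then have "wins_within G (Suc (Max (N ` {r'. step G r r'}))) C r" using assms(2) by auto
  then show ?thesis unfolding winning_def by blast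
qed

lemma winning_catch:
  assumes "finite (parcs G)" and "q \<in> set C" "step G q r"
  shows "winning G C r"
proof -
  obtain i where i: "i < length C" "C ! i = q" using assms(2) by (metis in_set_conv_nth)
  have "list_all2 (step G) C (C[i := r])"
    using i assms(3) by (auto simp: list_all2_conv_all_nth nth_list_update step_refl)
  moreover have "r \<in> set (C[i := r])" using i by (simp add: set_update_memI)
  ultimately show ?thesis using winning_move[OF assms(1)] by blast
qed

text \<open>The strategy looks only at the last positions and makes the least sufficient number of
  rounds drop; this number cannot drop forever.\<close>

lemma cops_suffice_if_winning:
  fixes G :: "'a pair_pre_digraph"
  assumes "pair_graph G" and C0: "placement G k C0" and win: "\<And>r. r \<in> pverts G \<Longrightarrow> winning G C0 r"
  shows "cops_suffice G k"
proof -
  interpret pair_graph G by fact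
  define good where "good C r C' \<longleftrightarrow> list_all2 (step G) C C' \<and>
    (\<forall>r'. step G r r' \<longrightarrow> r \<in> set C' \<or> wins_within G ((LEAST n. wins_within G n C r) - 1) C' r')"
    for C C' :: "'a list" and r
  define \<sigma> :: "'a cop_strategy" where "\<sigma> cs rs =
    (if cs = [] then C0 else if \<exists>C'. good (last cs) (last rs) C' then SOME C'. good (last cs) (last
        rs) C'
     else last cs)" for cs rs
  have good: "good (last cs) (last rs) (\<sigma> cs rs)" if "cs \<noteq> []"
      "\<exists>C'. good (last cs) (last rs) C'" for cs rs
    using that by (simp add: \<sigma>_def someI_ex[OF that(2)])
  have legal: "legal_cop_strategy G k \<sigma>"
    unfolding legal_cop_strategy_def
  proof (intro conjI allI impI)
    fix cs rs assume "cs \<noteq> ([] :: 'a list list)"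
    then show "list_all2 (step G) (last cs) (\<sigma> cs rs)"
      using good[of cs rs] by (cases "\<exists>C'. good (last cs) (last rs) C'") (auto simp: good_def \<sigma>_def
          list_all2_same step_refl)
  qed (simp add: \<sigma>_def C0)
  moreover have "cops_win \<sigma> \<rho>" if \<rho>: "legal_robber_strategy G \<rho>" for \<rho>
  proof -
    define cs where "cs n = fst (play \<sigma> \<rho> n)" for n
    define rs where "rs n = snd (play \<sigma> \<rho> n)" for n
    have cs_Suc: "cs (Suc n) = cs n @ [\<sigma> (cs n) (rs n)]" for n
      by (simp add: cs_def rs_def Let_def split: prod.splits)
    have rs_Suc: "rs (Suc n) = rs n @ [\<rho> (cs (Suc n)) (rs n)]" for n
      by (simp add: cs_def rs_def Let_def split: prod.splits)
    have start: "cs 0 = []" "rs 0 = []" by (simp_all add: cs_def rs_def)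
    have stay: "v \<in> pverts G" if "u \<in> pverts G" "step G u v" for u v
      using that wellformed by (fastforce simp: step_def)
    have move: "step G (last (rs (Suc n))) (last (rs (Suc (Suc n))))" if
        "last (rs (Suc n)) \<in> pverts G" for n
    proof -
      have "rs (Suc n) \<noteq> []" using rs_Suc by simp
      then have "step G (last (rs (Suc n))) (\<rho> (cs (Suc (Suc n))) (rs (Suc n)))"
        using \<rho> that unfolding legal_robber_strategy_def by blast
      then show ?thesis by (simp add: rs_Suc[of "Suc n"])
    qed
    have rs_in: "last (rs (Suc n)) \<in> pverts G" for n
    proof (induction n)
      case 0
      then show ?case using \<rho> by (simp add: rs_Suc start legal_robber_strategy_def)
    next
      case (Suc n)
      then show ?case using stay move by blast
    qed
    note robber_step = move[OF rs_in]
    have main: "wins_within G n (last (cs (Suc m))) (last (rs (Suc m))) \<Longrightarrow>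
      \<exists>m. last (rs (Suc m)) \<in> set (last (cs (Suc m))) \<or>
          last (rs (Suc m)) \<in> set (\<sigma> (cs (Suc m)) (rs (Suc m)))" for n m
    proof (induction n arbitrary: m)
      case 0
      then show ?case by auto
    next
      case (Suc n)
      let ?C = "last (cs (Suc m))" and ?r = "last (rs (Suc m))"
      show ?case
      proof (cases "?r \<in> set ?C")
        case False
        define n0 where "n0 = (LEAST n. wins_within G n ?C ?r)"
        have n0: "wins_within G n0 ?C ?r" "n0 \<le> Suc n"
          unfolding n0_def using Suc.prems by (rule LeastI, rule Least_le)
        with False obtain n1 where n1: "n0 = Suc n1" by (cases n0) auto
        then have "\<exists>C'. good ?C ?r C'" using n0 False by (auto simp: good_def n0_def[symmetric])
        then have g: "good ?C ?r (\<sigma> (cs (Suc m)) (rs (Suc m)))" by (intro good) (simp_all add: cs_Suc)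
        show ?thesis
        proof (cases "?r \<in> set (\<sigma> (cs (Suc m)) (rs (Suc m)))")
          case False
          have "wins_within G n1 (last (cs (Suc (Suc m)))) (last (rs (Suc (Suc m))))"
            using g robber_step[of m] False n1 by (simp add: good_def n0_def[symmetric] cs_Suc[of
                "Suc m"])
          then have "wins_within G n (last (cs (Suc (Suc m)))) (last (rs (Suc (Suc m))))"
            using wins_within_mono n0 n1 by (metis Suc_le_mono)
          then show ?thesis by (rule Suc.IH)
        qed blast
      qed blast
    qed
    have "last (cs (Suc 0)) = C0" by (simp add: cs_Suc start \<sigma>_def)
    then obtain n where "wins_within G n (last (cs (Suc 0))) (last (rs (Suc 0)))"
      using win rs_in[of 0] by (auto simp: winning_def)
    from main[OF this] obtain m where "last (rs (Suc m)) \<in> set (last (cs (Suc m))) \<or>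
        last (rs (Suc m)) \<in> set (\<sigma> (cs (Suc m)) (rs (Suc m)))" by blast
    then show ?thesis unfolding cops_win_def cs_def rs_def
      by (intro exI[of _ "Suc m"]) (simp add: Let_def split: prod.splits)
  qed
  ultimately show ?thesis unfolding cops_suffice_def by blast
qed

section \<open>Guarding a path\<close>

text \<open>Only the point that is entered has to lie in \<open>X\<close>, so a walk may start
  outside \<open>X\<close>.\<close>

definition into :: "point set \<Rightarrow> point \<Rightarrow> point \<Rightarrow> bool" where
  "into X p q \<longleftrightarrow> adj p q \<and> q \<in> X"

definition lattice_connected :: "point set \<Rightarrow> bool" where
  "lattice_connected X \<longleftrightarrow> (\<forall>p\<in>X. \<forall>q\<in>X. (into X)\<^sup>*\<^sup>* p q)"

lemma into_mono: "(into X)\<^sup>*\<^sup>* p q \<Longrightarrow> X \<subseteq> Y \<Longrightarrow> (into Y)\<^sup>*\<^sup>* p q"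
  by (rule rtranclp_mono[THEN predicate2D]) (auto simp: into_def)

lemma into_end: "(into X)\<^sup>*\<^sup>* p q \<Longrightarrow> p \<in> X \<Longrightarrow> q \<in> X"
  by (induction rule: rtranclp_induct) (auto simp: into_def)

lemma into_sym: "(into X)\<^sup>*\<^sup>* p q \<Longrightarrow> p \<in> X \<Longrightarrow> (into X)\<^sup>*\<^sup>* q p"
proof (induction rule: rtranclp_induct)
  case (step y z)
  then have "into X z y" using into_end[OF step.hyps(1)] by (auto simp: into_def adj_sym)
  then show ?case using step by (meson converse_rtranclp_into_rtranclp)
qed simp

text \<open>At the first step out of \<open>K\<close> the piece walked so far is reversed. The
  result starts at the exit point \<open>c\<close> and then stays in \<open>K\<close>, which is the
  form required by \<open>hop\<close>.\<close>

lemma into_exit: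
  assumes "(into X)\<^sup>*\<^sup>* a q" "a \<in> X \<inter> K"
  shows "q \<in> K \<and> (into (X \<inter> K))\<^sup>*\<^sup>* a q \<or> (\<exists>c b. c \<in> X - K \<and> b \<in> X \<inter> K \<and> adj b c \<and>
      (into (X \<inter> K))\<^sup>*\<^sup>* c a)"
  using assms(1)
proof (induction rule: rtranclp_induct)
  case base
  then show ?case using assms(2) by simp
next
  case (step y z)
  then have z: "adj y z" "z \<in> X" by (auto simp: into_def)
  from step.IH show ?case
  proof
    assume y: "y \<in> K \<and> (into (X \<inter> K))\<^sup>*\<^sup>* a y"
    then have yX: "y \<in> X \<inter> K" "(into (X \<inter> K))\<^sup>*\<^sup>* y a"
      using into_end[OF _ assms(2)] into_sym[OF _ assms(2)] by blast+
    show ?thesis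
    proof (cases "z \<in> K")
      case True
      then have "into (X \<inter> K) y z" using z by (simp add: into_def)
      then show ?thesis using y True by (meson rtranclp.rtrancl_into_rtrancl)
    next
      case False
      have "into (X \<inter> K) z y" using z yX by (simp add: into_def adj_sym)
      then have "(into (X \<inter> K))\<^sup>*\<^sup>* z a" using yX by (meson converse_rtranclp_into_rtranclp)
      then show ?thesis using False yX z by blast
    qed
  qed blast
qed

text \<open>The string representation in lattice form. \<open>S_step\<close> speaks of
  \<open>step\<close> instead of arcs, so that it also covers \<open>u = v\<close>.\<close>

locale string_system =
  fixes G :: "'a pair_pre_digraph" and S :: "'a \<Rightarrow> point set"
  assumes graph: "pair_graph G"
    and finite_S: "v \<in> pverts G \<Longrightarrow> finite (S v)"
    and S_ne: "v \<in> pverts G \<Longrightarrow> S v \<noteq> {}"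
    and S_conn: "v \<in> pverts G \<Longrightarrow> lattice_connected (S v)"
    and S_step: "u \<in> pverts G \<Longrightarrow> v \<in> pverts G \<Longrightarrow> step G u v \<longleftrightarrow> S u \<inter> S v \<noteq> {}"
    and linked: "u \<in> pverts G \<Longrightarrow> v \<in> pverts G \<Longrightarrow> (step G)\<^sup>*\<^sup>* u v"
begin

sublocale pair_graph G by (rule graph)

lemma step_pverts: "step G u v \<Longrightarrow> u \<in> pverts G \<Longrightarrow> v \<in> pverts G"
  using wellformed by (fastforce simp: step_def)

lemma finite_parcs: "finite (parcs G)"
  using pair_finite_arcs by simp

text \<open>The start \<open>b\<close> of a hop need not lie in \<open>K\<close>: it may be a point of the tree bounding the territory.\<close>

definition hop :: "point set \<Rightarrow> point \<Rightarrow> point \<Rightarrow> bool" where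
  "hop K b a \<longleftrightarrow> (\<exists>s\<in>pverts G. b \<in> S s \<and> (into (S s \<inter> K))\<^sup>*\<^sup>* b a)"

text \<open>Hops end in \<open>K\<close>; thus points of the tree outside \<open>K\<close> are never
  compared directly with one another.\<close>

definition lip :: "point set \<Rightarrow> point set \<Rightarrow> (point \<Rightarrow> nat) \<Rightarrow> bool" where
  "lip K T D \<longleftrightarrow> (\<forall>b\<in>K \<union> T. \<forall>a\<in>K. hop K b a \<longrightarrow> D a \<le> D b + 1 \<and> D b \<le> D a + 1)"

text \<open>A label is an index into the walk \<open>P\<close>. The label function belongs to the
  guarded path: an old path keeps the function for which it was chosen.\<close>

definition guard :: "point set \<Rightarrow> point set \<Rightarrow> 'a list \<Rightarrow> (point \<Rightarrow> nat) \<Rightarrow> bool" where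
  "guard K T P D \<longleftrightarrow> P \<noteq> [] \<and> set P \<subseteq> pverts G \<and> (\<forall>i. Suc i < length P \<longrightarrow> step G (P ! i) (P ! Suc i)) \<and>
    (\<forall>c\<in>T. D c < length P \<and> c \<in> S (P ! D c)) \<and> lip K T D"

definition depth :: "(point \<Rightarrow> nat) \<Rightarrow> 'a \<Rightarrow> nat" where
  "depth D u = Min (D ` S u)"

text \<open>The truncated subtraction and the minimum clamp the position to the path.\<close>

definition target :: "'a list \<Rightarrow> (point \<Rightarrow> nat) \<Rightarrow> 'a \<Rightarrow> nat \<Rightarrow> nat" where
  "target P D u d = min (depth D u + d - 1) (length P - 1)"

definition posts :: "'a list \<Rightarrow> (point \<Rightarrow> nat) \<Rightarrow> 'a \<Rightarrow> 'a list" where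
  "posts P D u = map (\<lambda>d. P ! target P D u d) [0, 1, 2, 3]"

lemma hop_mono: "hop K b a \<Longrightarrow> K \<subseteq> K' \<Longrightarrow> hop K' b a"
  unfolding hop_def by (meson Int_mono into_mono order_refl)

lemma lip_mono: "lip K T D \<Longrightarrow> K' \<subseteq> K \<Longrightarrow> T' \<subseteq> K \<union> T \<Longrightarrow> lip K' T' D"
  unfolding lip_def by (meson Un_iff hop_mono subset_iff)

lemma guard_mono: "guard K T P D \<Longrightarrow> K' \<subseteq> K \<Longrightarrow> guard K' T P D"
  unfolding guard_def using lip_mono[of K T D K' T] by blast

lemma hop_within:
  assumes "u \<in> pverts G" "S u \<subseteq> K" "a \<in> S u" "b \<in> S u"
  shows "hop K a b"
proof -
  have "(into (S u))\<^sup>*\<^sup>* a b" using S_conn[OF assms(1)] assms by (simp add: lattice_connected_def)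
  moreover have "S u \<inter> K = S u" using assms by blast
  ultimately show ?thesis unfolding hop_def using assms by metis
qed

text \<open>Any two points of \<open>S u\<close> are one hop apart, so the labels on it take at most
  two consecutive values.\<close>

lemma depth_bounds:
  assumes "lip K T D" "u \<in> pverts G" "S u \<subseteq> K" "a \<in> S u"
  shows "depth D u \<le> D a" "D a \<le> depth D u + 1"
proof -
  have fin: "finite (D ` S u)" using finite_S assms by simp
  then show "depth D u \<le> D a" unfolding depth_def using assms by simp
  obtain b where "b \<in> S u" "D b = depth D u"
    unfolding depth_def using Min_in[OF fin] S_ne[OF assms(2)] by fastforce
  moreover have "hop K b a" using hop_within assms \<open>b \<in> S u\<close> by blast
  ultimately show "D a \<le> depth D u + 1" using assms unfolding lip_def by (metis UnI1 subsetD)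
qed

text \<open>The label of a common point exceeds either depth by at most one. Hence the guards can
  keep up with the robber.\<close>

lemma depth_step:
  assumes "lip K T D" "u \<in> pverts G" "S u \<subseteq> K" "w \<in> pverts G" "S w \<subseteq> K" "step G u w"
  shows "depth D u \<le> depth D w + 1" "depth D w \<le> depth D u + 1"
proof -
  obtain a where a: "a \<in> S u" "a \<in> S w" using S_step assms by blast
  show "depth D u \<le> depth D w + 1" "depth D w \<le> depth D u + 1"
    using depth_bounds[OF assms(1-3) a(1)] depth_bounds[OF assms(1,4,5) a(2)] by simp_all
qed

lemma guard_step:
  assumes "guard K T P D" "i < length P" "j < length P" "i \<le> j + 1" "j \<le> i + 1"
  shows "step G (P ! i) (P ! j)"
proof -
  have sym: "step G u v \<Longrightarrow> step G v u" for u v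
    using sym_arcs by (auto simp: step_def dest: symD arcs_symmetric)
  have "j = i \<or> j = Suc i \<or> i = Suc j" using assms by linarith
  then show ?thesis using assms sym unfolding guard_def by (auto simp: step_refl)
qed

lemma target_step:
  assumes "guard K T P D" "u \<in> pverts G" "S u \<subseteq> K" "w \<in> pverts G" "S w \<subseteq> K" "step G u w"
  shows "target P D u d \<le> target P D w d + 1" "target P D w d \<le> target P D u d + 1"
proof -
  have "lip K T D" using assms(1) by (simp add: guard_def)
  from depth_step[OF this assms(2-6)]
  show "target P D u d \<le> target P D w d + 1" "target P D w d \<le> target P D u d + 1"
    by (auto simp: target_def min_def)
qed

lemma target_less:
  assumes "guard K T P D"
  shows "target P D u d < length P"
proof -
  have "0 < length P" using assms by (simp add: guard_def)
  then show ?thesis by (simp add: target_def min_less_iff_disj)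
qed

text \<open>The labels of the points where the robber can cross the path range from one below to two above
  the depth of his last position; these are the four positions that are occupied.\<close>

lemma guard_catch:
  assumes g: "guard K T P D" and u: "u \<in> pverts G" "S u \<subseteq> K" and w: "w \<in> pverts G"
    and a: "a \<in> S u" "a \<in> S w" and c: "c \<in> S w" "c \<in> T" "hop K c a"
  shows "\<exists>q\<in>set (posts P D u). step G q w"
proof -
  have lip: "lip K T D" using g by (simp add: guard_def)
  have "D a \<le> D c + 1" "D c \<le> D a + 1" using lip c a u unfolding lip_def by blast+
  with depth_bounds[OF lip u a(1)] have "depth D u \<le> D c + 1" "D c \<le> depth D u + 2" by simp_all
  moreover have Dc: "D c < length P" "c \<in> S (P ! D c)" using g c by (auto simp: guard_def)
  \<comment> \<open>This offset undoes the shift by one in \<open>target\<close>; the minimum there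
    is inactive because \<open>D c < length P\<close>.\<close>
  ultimately have "target P D u (D c + 1 - depth D u) = D c" "D c + 1 - depth D u \<in> {0, 1, 2, 3}"
    by (auto simp: target_def)
  then have post: "P ! D c \<in> set (posts P D u)"
    unfolding posts_def set_map list.set by (intro image_eqI[where x = "D c + 1 - depth D u"]) simp_all
  have "P ! D c \<in> pverts G" using g Dc by (auto simp: guard_def)
  then have "step G (P ! D c) w" using S_step[OF _ w] Dc c by blast
  then show ?thesis using post by (rule bexI)
qed

text \<open>The counterpart of \<open>winning\<close> with the robber to move, the cops having just
  reached \<open>C\<close>.\<close>

definition flees :: "'a list \<Rightarrow> 'a \<Rightarrow> bool" where
  "flees C u \<longleftrightarrow> (\<forall>w. step G u w \<longrightarrow> winning G C w)"

lemma flees_mset: "flees C u \<Longrightarrow> mset C' = mset C \<Longrightarrow> flees C' u"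
  unfolding flees_def using winning_mset[of G C _ C'] by simp

lemma winningI:
  assumes "list_all2 (step G) C C'" "flees C' w"
  shows "winning G C w"
  using winning_move[OF finite_parcs assms(1)] assms(2) by (auto simp: flees_def)

lemma posts_step:
  assumes "guard K T P D" "u \<in> pverts G" "S u \<subseteq> K" "w \<in> pverts G" "S w \<subseteq> K" "step G u w"
  shows "list_all2 (step G) (posts P D u) (posts P D w)"
  using guard_step[OF assms(1)] target_less[OF assms(1)] target_step[OF assms]
  by (auto simp: posts_def)

lemma posts_pverts: "guard K T P D \<Longrightarrow> set (posts P D u) \<subseteq> pverts G"
  using target_less[of K T P D u] by (auto simp: posts_def guard_def)

end

section \<open>The game in a territory bounded by two guarded paths\<close>

locale two_guards = string_system +
  fixes K X Y :: "point set" and P Q :: "'a list" and D E :: "point \<Rightarrow> nat"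
  assumes P: "guard K X P D" and Q: "guard K Y Q E"
    and exit: "b \<in> K \<Longrightarrow> adj b c \<Longrightarrow> c \<notin> K \<Longrightarrow> c \<in> X \<union> Y"
begin

text \<open>A set that leaves \<open>K\<close> does so at a guarded point \<open>c\<close>, and the
  part of it traversed before is a hop from \<open>c\<close> back to the point \<open>a\<close>
  shared with the old set of the robber.\<close>

lemma stays_or_caught:
  assumes "u \<in> pverts G" "S u \<subseteq> K" "step G u w"
  shows "S w \<subseteq> K \<or> (\<exists>q\<in>set (posts P D u @ posts Q E u). step G q w)"
proof (rule disjCI)
  assume nc: "\<not> (\<exists>q\<in>set (posts P D u @ posts Q E u). step G q w)"
  have w: "w \<in> pverts G" using step_pverts assms by blast
  obtain a where a: "a \<in> S u" "a \<in> S w" using S_step[OF assms(1) w] assms(3) by blast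
  show "S w \<subseteq> K"
  proof
    fix q assume q: "q \<in> S w"
    have aK: "a \<in> S w \<inter> K" using a assms by blast
    have "(into (S w))\<^sup>*\<^sup>* a q" using S_conn[OF w] a q by (simp add: lattice_connected_def)
    from into_exit[OF this aK] show "q \<in> K"
    proof
      assume "\<exists>c b. c \<in> S w - K \<and> b \<in> S w \<inter> K \<and> adj b c \<and> (into (S w \<inter> K))\<^sup>*\<^sup>* c a"
      then obtain c b where c: "c \<in> S w" "c \<notin> K" "b \<in> K" "adj b c" "(into (S w \<inter> K))\<^sup>*\<^sup>* c a" by blast
      have "hop K c a" using c w by (auto simp: hop_def)
      then have "\<exists>q\<in>set (posts P D u @ posts Q E u). step G q w"
        using exit[OF c(3,4,2)] guard_catch[OF P assms(1,2) w a c(1)] guard_catch[OF Q assms(1,2) w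
            a c(1)] by auto
      then show ?thesis using nc by blast
    qed simp
  qed
qed

text \<open>The eight guards follow the robber by themselves; what has to be supplied is the reply
  of the free cops \<open>C\<close>.\<close>

lemma flees_round:
  assumes u: "u \<in> pverts G" "S u \<subseteq> K"
    and move: "\<And>w. w \<in> pverts G \<Longrightarrow> S w \<subseteq> K \<Longrightarrow> step G u w \<Longrightarrow>
      (\<exists>q\<in>set C. step G q w) \<or> (\<exists>C'. list_all2 (step G) C C' \<and> flees (posts P D w @ posts Q E w @ C') w)"
  shows "flees (posts P D u @ posts Q E u @ C) u"
  unfolding flees_def
proof (intro allI impI)
  fix w assume st: "step G u w"
  let ?C = "posts P D u @ posts Q E u @ C"
  have w: "w \<in> pverts G" using step_pverts st u by blast
  show "winning G ?C w"
  proof (cases "\<exists>q\<in>set ?C. step G q w")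
    case True
    then show ?thesis using winning_catch[OF finite_parcs] by blast
  next
    case False
    then have wK: "S w \<subseteq> K" using stays_or_caught[OF u st] by auto
    then obtain C' where "list_all2 (step G) C C'" "flees (posts P D w @ posts Q E w @ C') w"
      using move[OF w wK st] False by auto
    then show ?thesis
      using posts_step[OF P u w wK st] posts_step[OF Q u w wK st]
      by (intro winningI[of _ "posts P D w @ posts Q E w @ C'"] list_all2_appendI)
  qed
qed

text \<open>Waiting pads a walk, so that all free cops can arrive at the same time.\<close>

lemma relpowp_step_mono:
  assumes "((step G) ^^ m) c d" "m \<le> n"
  shows "((step G) ^^ n) c d"
  using assms(2)
proof (induction n rule: dec_induct)
  case (step n)
  then show ?case using step_refl by (metis relpowp_Suc_I)
qed (rule assms(1))

text \<open>The third group of cops walks to the start of the path and then climbs it; since the target of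
  a cop moves by at most one in each round, a cop that is below its target stays so until it meets it.\<close>

lemma third_guard:
  assumes R: "guard K Z R F" and Z: "Z \<subseteq> K \<union> X \<union> Y"
    and goal: "\<And>u. u \<in> pverts G \<Longrightarrow> S u \<subseteq> K \<Longrightarrow> S u \<inter> Z = {} \<Longrightarrow>
      flees (posts P D u @ posts Q E u @ posts R F u) u"
    and C: "length C = 4" "set C \<subseteq> pverts G" and u: "u \<in> pverts G" "S u \<subseteq> K"
  shows "flees (posts P D u @ posts Q E u @ C) u"
proof -
  \<comment> \<open>The set of the robber may still meet \<open>Z\<close> when the third group gets
    into place. His next move either meets \<open>Z\<close>, and he is caught, or leads to the
    situation of \<open>goal\<close>.\<close>
  have synced: "flees (posts P D u @ posts Q E u @ posts R F u) u" if u: "u \<in> pverts G" "S u \<subseteq> K" for u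
  proof (rule flees_round[OF u])
    fix w assume w: "w \<in> pverts G" "S w \<subseteq> K" "step G u w"
    show "(\<exists>q\<in>set (posts R F u). step G q w) \<or>
      (\<exists>C'. list_all2 (step G) (posts R F u) C' \<and> flees (posts P D w @ posts Q E w @ C') w)"
    proof (cases "S w \<inter> Z = {}")
      case True
      then show ?thesis using posts_step[OF R u w] goal[OF w(1,2)] by blast
    next
      case False
      then obtain c where c: "c \<in> S w" "c \<in> Z" by blast
      obtain a where a: "a \<in> S u" "a \<in> S w" using S_step[OF u(1) w(1)] w(3) by blast
      have "hop K c a" using hop_within[OF w(1,2)] a c by blast
      then show ?thesis using guard_catch[OF R u w(1) a c] by blast
    qed
  qed
  \<comment> \<open>The cop for offset \<open>d\<close> is at \<open>R ! j d\<close>. The lower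
    bound \<open>length R - n\<close> on the positions of late cops rises in every round; at
    \<open>n = 0\<close> no cop can be below its target any more.\<close>
  have chase: "flees (posts P D u @ posts Q E u @ map (\<lambda>d. R ! j d) [0, 1, 2, 3]) u"
    if "u \<in> pverts G" "S u \<subseteq> K" and
      "\<And>d. j d = target R F u d \<or> length R - n \<le> j d \<and> j d < target R F u d" for j u n
    using that
  proof (induction n arbitrary: j u)
    case 0
    then have "j d = target R F u d" for d using target_less[OF R, of u d]
        by (metis diff_zero leD less_trans not_less)
    then show ?case using synced[OF 0(1,2)] by (simp add: posts_def)
  next
    case (Suc n)
    show ?case
    proof (rule flees_round[OF Suc.prems(1,2)])
      fix w assume w: "w \<in> pverts G" "S w \<subseteq> K" "step G u w"
      define k where "k d = min (j d + 1) (target R F w d)" for d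
      note ts = target_step[OF R Suc.prems(1,2) w] target_less[OF R, of u] target_less[OF R, of w]
      have j: "j d \<le> target R F u d" for d using Suc.prems(3)[of d] by auto
      have "k d = target R F w d \<or> length R - n \<le> k d \<and> k d < target R F w d" for d
        using Suc.prems(3)[of d] ts[of d] by (auto simp: k_def)
      then have "flees (posts P D w @ posts Q E w @ map (\<lambda>d. R ! k d) [0, 1, 2, 3]) w"
        by (rule Suc.IH[OF w(1,2)])
      moreover have "step G (R ! j d) (R ! k d)" for d
        using ts[of d] j[of d] by (intro guard_step[OF R]) (auto simp: k_def)
      then have "list_all2 (step G) (map (\<lambda>d. R ! j d) [0, 1, 2, 3]) (map (\<lambda>d. R ! k d) [0, 1, 2, 3])"
        by simp
      ultimately show "(\<exists>q\<in>set (map (\<lambda>d. R ! j d) [0, 1, 2, 3]). step G q w) \<or>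
        (\<exists>C'. list_all2 (step G) (map (\<lambda>d. R ! j d) [0, 1, 2, 3]) C' \<and>
            flees (posts P D w @ posts Q E w @ C') w)"
        by blast
    qed
  qed
  have approach: "flees (posts P D u @ posts Q E u @ C) u"
    if "u \<in> pverts G" "S u \<subseteq> K" "length C = 4" "\<And>c. c \<in> set C \<Longrightarrow> ((step G) ^^ n) c (R ! 0)" for C u n
    using that
  proof (induction n arbitrary: C u)
    case 0
    have "replicate (length C) (R ! 0) = C" by (rule replicate_length_same) (use 0(4) in simp)
    then have "C = map (\<lambda>d. R ! 0) [0, 1, 2, 3 :: nat]" using 0(3) by (simp add: numeral_eq_Suc)
    moreover have "0 = target R F u d \<or> length R - length R \<le> 0 \<and> 0 < target R F u d" for d by auto
    ultimately show ?case using chase[OF 0(1,2), of "\<lambda>d. 0" "length R"] by simp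
  next
    case (Suc n)
    have "\<exists>c'. step G c c' \<and> ((step G) ^^ n) c' (R ! 0)" if "c \<in> set C" for c
      using Suc.prems(4)[OF that] by (meson relpowp_Suc_D2)
    then obtain h where h: "\<And>c. c \<in> set C \<Longrightarrow> step G c (h c) \<and> ((step G) ^^ n) (h c) (R ! 0)" by metis
    show ?case
    proof (rule flees_round[OF Suc.prems(1,2)])
      fix w assume w: "w \<in> pverts G" "S w \<subseteq> K" "step G u w"
      have "flees (posts P D w @ posts Q E w @ map h C) w"
        using h Suc.prems(3) by (intro Suc.IH[OF w(1,2)]) auto
      moreover have "list_all2 (step G) C (map h C)" using h by (auto simp: list_all2_conv_all_nth)
      ultimately show "(\<exists>q\<in>set C. step G q w) \<or>
        (\<exists>C'. list_all2 (step G) C C' \<and> flees (posts P D w @ posts Q E w @ C') w)" by blast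
    qed
  qed
  have R0: "R ! 0 \<in> pverts G" using R by (auto simp: guard_def)
  have "\<exists>n. ((step G) ^^ n) c (R ! 0)" if "c \<in> set C" for c
    using linked[OF _ R0] C(2) that rtranclp_imp_relpowp by fast
  then obtain N where N: "\<And>c. c \<in> set C \<Longrightarrow> ((step G) ^^ N c) c (R ! 0)" by metis
  have "((step G) ^^ Max (N ` set C)) c (R ! 0)" if "c \<in> set C" for c
    using relpowp_step_mono[OF N[OF that]] that by simp
  then show ?thesis using approach[OF u C(1)] by blast
qed

end

section \<open>Shortest paths to a labelled tree\<close>

lemma anc_cong:
  assumes "tree T r par rk" "x \<in> T" "\<And>c. c \<in> T \<Longrightarrow> par' c = par c"
  shows "anc par' r x = anc par r x"
proof -
  have 1: "c \<in> anc par r x" if "c \<in> anc par' r x" for c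
    using that
  proof induction
    case (up c)
    then have "par' c = par c" using anc_subset[OF assms(1,2)] assms(3) by blast
    then show ?case using anc.up[OF up.IH up.hyps(2)] by simp
  qed (rule anc.self)
  have 2: "c \<in> anc par' r x" if "c \<in> anc par r x" for c
    using that
  proof induction
    case (up c)
    then have "par' c = par c" using anc_subset[OF assms(1,2)] assms(3) by blast
    then show ?case using anc.up[OF up.IH up.hyps(2)] by simp
  qed (rule anc.self)
  from 1 2 show ?thesis by blast
qed

lemma path_edges_cong:
  assumes "tree T r par rk" "x \<in> T" "\<And>c. c \<in> T \<Longrightarrow> par' c = par c"
  shows "path_edges par' r x = path_edges par r x"
proof -
  have "par' c = par c" if "c \<in> anc par r x - {r}" for c
      using anc_subset[OF assms(1,2)] assms(3) that by blast
  then have "(\<exists>c\<in>anc par r x - {r}. ends e = {c, par' c}) = (\<exists>c\<in>anc par r x - {r}. ends e = {c,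
      par c})" for e
    by (intro bex_cong refl) simp
  moreover have "anc par' r x = anc par r x" using assms by (rule anc_cong)
  ultimately show ?thesis unfolding path_edges_def by simp
qed

lemma fund_cycle_ends:
  assumes "e' \<in> fund_cycle par r x y e" "ends e = {x, y}"
  shows "ends e' \<subseteq> anc par r x \<union> anc par r y"
proof -
  have "ends e' \<subseteq> anc par r x" if e': "e' \<in> path_edges par r x" for x
  proof -
    obtain c where c: "c \<in> anc par r x" "c \<noteq> r" "ends e' = {c, par c}"
      using e' unfolding path_edges_def by blast
    then show ?thesis using anc.up by simp
  qed
  note sub = this
  have "e' \<in> path_edges par r x \<or> e' \<in> path_edges par r y \<or> e' = e"
    using assms(1) unfolding fund_cycle_def by blast
  then show ?thesis
  proof (elim disjE)
    assume "e' = e"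
    then show ?thesis using assms(2) anc.self by simp
  qed (use sub in blast)+
qed

section \<open>Lattice points enclosed by a set of triangles\<close>

definition inner :: "triangle set \<Rightarrow> point set" where
  "inner A = {p. \<forall>t. p \<in> corners t \<longrightarrow> t \<in> A}"

text \<open>No boundary edge ends at a point off \<open>T\<close>, so one triangle of the ring
  around \<open>p\<close> decides for all.\<close>

lemma innerI:
  assumes "p \<in> corners t" "t \<in> A" "p \<notin> T" "\<And>e. e \<in> bd A \<Longrightarrow> ends e \<subseteq> T"
  shows "p \<in> inner A"
proof -
  have "e \<notin> bd A" if "p \<in> ends e" for e using assms(3,4) that by blast
  then show ?thesis using link_connected[OF assms(1), of _ A] assms(2) unfolding inner_def by blast
qed

lemma inner_adj:
  assumes "p \<in> inner A" "adj p q" "q \<notin> T" "\<And>e. e \<in> bd A \<Longrightarrow> ends e \<subseteq> T"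
  shows "q \<in> inner A"
proof -
  obtain e where e: "ends e = {p, q}" using assms(2) by (auto simp: adj_def)
  then have "p \<in> corners (side1 e)" "q \<in> corners (side1 e)" using ends_subset_corners_iff[of e
      "side1 e"] by auto
  moreover from this have "side1 e \<in> A" using assms(1) unfolding inner_def by blast
  ultimately show ?thesis using assms(3,4) by (intro innerI[of q "side1 e"])
qed

lemma inner_connected:
  assumes "(into X)\<^sup>*\<^sup>* p q" "p \<in> inner A" "X \<inter> T = {}" "\<And>e. e \<in> bd A \<Longrightarrow> ends e \<subseteq> T"
  shows "q \<in> inner A"
  using assms(1)
proof (induction rule: rtranclp_induct)
  case (step y z)
  then have "adj y z" "z \<notin> T" using assms(3) by (auto simp: into_def)
  then show ?case using inner_adj[OF step.IH _ _ assms(4)] by blast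
qed (rule assms(2))

lemma some_triangle: "\<exists>t. p \<in> corners t"
proof -
  have "p \<in> corners (False, p)" by (cases p) simp
  then show ?thesis ..
qed

context string_system
begin

text \<open>Consecutive points with the same label belong to the same vertex, so that a tree path traces a
  walk in \<open>G\<close> with one vertex per label.\<close>

definition labelled_tree ::
  "point set \<Rightarrow> point \<Rightarrow> (point \<Rightarrow> point) \<Rightarrow> (point \<Rightarrow> nat) \<Rightarrow> (point \<Rightarrow> 'a) \<Rightarrow> (point \<Rightarrow> nat) \<Rightarrow> bool" where
  "labelled_tree T r par rk str D \<longleftrightarrow> tree T r par rk \<and> (\<forall>c\<in>T. str c \<in> pverts G \<and> c \<in> S (str c)) \<and>
      D r = 0 \<and>
    (\<forall>c\<in>T - {r}. D c = D (par c) \<and> str c = str (par c) \<or> D c = Suc (D (par c)) \<and>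
        step G (str (par c)) (str c))"

lemma labelled_tree_guard:
  assumes lt: "labelled_tree T r par rk str D" and lip: "lip K T D" and x: "x \<in> T"
  obtains P where "guard K (anc par r x) P D"
proof -
  have T: "tree T r par rk" using lt by (simp add: labelled_tree_def)
  have "\<exists>P. length P = Suc (D x) \<and> P ! D x = str x \<and> set P \<subseteq> pverts G \<and>
    (\<forall>i. Suc i < length P \<longrightarrow> step G (P ! i) (P ! Suc i)) \<and> (\<forall>c\<in>anc par r x. D c \<le> D x \<and> c \<in> S (P ! D c))"
    using x
  proof (induction "rk x" arbitrary: x rule: less_induct)
    case less
    have sx: "str x \<in> pverts G" "x \<in> S (str x)" using lt less.prems by (auto simp: labelled_tree_def)
    show ?case
    proof (cases "x = r")
      case True
      then have "D x = 0" using lt by (simp add: labelled_tree_def)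
      then show ?thesis using True sx by (intro exI[of _ "[str x]"]) (simp add: anc_root)
    next
      case False
      note p = tree_par[OF T less.prems False]
      obtain P where P: "length P = Suc (D (par x))" "P ! D (par x) = str (par x)" "set P \<subseteq> pverts G"
        "\<And>i. Suc i < length P \<Longrightarrow> step G (P ! i) (P ! Suc i)"
        "\<And>c. c \<in> anc par r (par x) \<Longrightarrow> D c \<le> D (par x) \<and> c \<in> S (P ! D c)"
        using less.hyps[OF p(3,1)] by blast
      consider "D x = D (par x)" "str x = str (par x)" | "D x = Suc (D (par x))"
          "step G (str (par x)) (str x)"
        using lt less.prems False by (auto simp: labelled_tree_def)
      then show ?thesis
      proof cases
        case 1
        then show ?thesis using P sx by (intro exI[of _ P]) (auto simp: anc_step[OF False])
      next
        case 2
        have "step G ((P @ [str x]) ! i) ((P @ [str x]) ! Suc i)" if "Suc i < length (P @ [str x])" for i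
        proof (cases "Suc i < length P")
          case False
          then have "i = D (par x)" using that P(1) by simp
          then show ?thesis using 2 P(1,2) by (simp add: nth_append)
        qed (use P(4)[of i] in \<open>simp add: nth_append\<close>)
        moreover have "D c \<le> D x \<and> c \<in> S ((P @ [str x]) ! D c)" if "c \<in> anc par r x" for c
        proof (cases "c = x")
          case False
          then have "D c \<le> D (par x) \<and> c \<in> S (P ! D c)" using P(5) that anc_step[OF \<open>x \<noteq> r\<close>] by blast
          then show ?thesis using P(1) 2 by (simp add: nth_append)
        qed (use 2 P(1) sx in \<open>simp add: nth_append\<close>)
        ultimately show ?thesis using P(1,3) 2 sx by (intro exI[of _
            "P @ [str x]"]) (simp add: nth_append)
      qed
    qed
  qed
  then obtain P where P: "length P = Suc (D x)" "set P \<subseteq> pverts G"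
    "\<And>i. Suc i < length P \<Longrightarrow> step G (P ! i) (P ! Suc i)"
        "\<And>c. c \<in> anc par r x \<Longrightarrow> D c \<le> D x \<and> c \<in> S (P ! D c)"
    by blast
  have "lip K (anc par r x) D" using lip_mono[OF lip order_refl] anc_subset[OF T x] by blast
  then have "guard K (anc par r x) P D" unfolding guard_def using P by fastforce
  then show ?thesis by (rule that)
qed

lemma labelled_tree_subset:
  assumes "labelled_tree T r par rk str D" "T' \<subseteq> T" "r \<in> T'" "\<And>c. c \<in> T' \<Longrightarrow> c \<noteq> r \<Longrightarrow> par c \<in> T'"
  shows "labelled_tree T' r par rk str D"
  using assms finite_subset unfolding labelled_tree_def tree_def by (auto dest: subsetD)

text \<open>In the second alternative the sets of \<open>str b\<close> and \<open>s\<close> meet at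
  \<open>b\<close>, which gives the step in \<open>G\<close>.\<close>

lemma labelled_tree_insert:
  assumes lt: "labelled_tree T r par rk str D" and "c \<notin> T" "b \<in> T" "adj c b" "s \<in> pverts G" "c \<in> S s"
    and "D c = D b \<and> s = str b \<or> D c = Suc (D b) \<and> b \<in> S s"
  shows "labelled_tree (insert c T) r (par(c := b)) (rk(c := Suc (rk b))) (str(c := s)) D"
proof -
  have "step G (str b) s" if "b \<in> S s"
    using S_step[of "str b" s] that lt assms(3,5) by (auto simp: labelled_tree_def)
  moreover have "c \<noteq> b" "c \<noteq> r" using assms(2,3) lt by (auto simp: labelled_tree_def tree_def)
  moreover have "par d \<noteq> c" if "d \<in> T" "d \<noteq> r" for d
  proof -
    have "tree T r par rk" using lt by (simp add: labelled_tree_def)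
    from tree_par(1)[OF this that] show ?thesis using assms(2) by blast
  qed
  ultimately show ?thesis
    using assms unfolding labelled_tree_def tree_def by auto
qed

text \<open>The label rises only on leaving \<open>b\<close>; all later points of the walk share the
  label \<open>Suc m\<close>. That every new point is assigned \<open>s\<close> is part of the
  induction, so that the next point may hang from any of them.\<close>

lemma grow_along_string:
  assumes lt: "labelled_tree T r par rk str D" and b: "b \<in> T" "D b = m" "s \<in> pverts G" "b \<in> S s"
    and walk: "(into (S s \<inter> L))\<^sup>*\<^sup>* b z" and L: "L \<inter> T = {}" "\<And>p. p \<in> L \<Longrightarrow> D p = Suc m"
  shows "\<exists>T' par' rk' str'. labelled_tree T' r par' rk' str' D \<and> T \<subseteq> T' \<and> T' \<subseteq> T \<union> L \<and> z \<in> T' \<and>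
    (\<forall>c\<in>T. par' c = par c)"
proof -
  have "(z = b \<or> z \<in> L) \<and> (\<exists>T' par' rk' str'. labelled_tree T' r par' rk' str' D \<and> T \<subseteq> T' \<and>
      T' \<subseteq> T \<union> L \<and> z \<in> T' \<and>
    (\<forall>c\<in>T. par' c = par c) \<and> (\<forall>c\<in>T' - T. str' c = s))"
    using walk
  proof (induction rule: rtranclp_induct)
    case base
    then show ?case using lt b(1) by blast
  next
    case (step y z)
    then have z: "adj y z" "z \<in> S s" "z \<in> L" by (auto simp: into_def)
    from step.IH obtain T' par' rk' str' where IH: "labelled_tree T' r par' rk' str' D" "T \<subseteq> T'"
        "T' \<subseteq> T \<union> L"
      "y \<in> T'" "\<And>c. c \<in> T \<Longrightarrow> par' c = par c" "\<And>c. c \<in> T' - T \<Longrightarrow> str' c = s" and y: "y = b \<or> y \<in> L" by blast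
    show ?case
    proof (cases "z \<in> T'")
      case True
      then show ?thesis using IH z by blast
    next
      case False
      have "D z = D y \<and> s = str' y \<or> D z = Suc (D y) \<and> y \<in> S s"
      proof (cases "y = b")
        case False
        then have "y \<in> L" "y \<notin> T" using y L by blast+
        then show ?thesis using L(2) z(3) IH(4,6) by simp
      qed (use b L(2) z(3) in simp)
      then have "labelled_tree (insert z T') r (par'(z := y)) (rk'(z := Suc (rk' y))) (str'(z := s)) D"
        using labelled_tree_insert[OF IH(1) False IH(4) adj_sym[OF z(1)] b(3) z(2)] by blast
      moreover have "\<forall>c\<in>T. (par'(z := y)) c = par c" using IH(2,5) False by auto
      moreover have "\<forall>c\<in>insert z T' - T. (str'(z := s)) c = s" using IH(6) by auto
      ultimately show ?thesis using IH(2,3) z(3)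
        by (intro conjI disjI2, simp, intro exI[of _ "insert z T'"] exI) auto
    qed
  qed
  then show ?thesis by blast
qed

text \<open>Along a hop from label \<open>m\<close> to label \<open>Suc m\<close> no other labels
  occur. After its last point of label \<open>m\<close> the walk thus stays in a single level, and
  the tree grown up to that point uses labels at most \<open>m\<close> in \<open>K\<close> and
  avoids this level.\<close>

lemma grow_tree:
  assumes lt: "labelled_tree T r par rk str D" and lip: "lip K T D" and disj: "K \<inter> T = {}"
    and descent: "\<And>a. a \<in> K \<Longrightarrow> \<exists>b\<in>K \<union> T. hop K b a \<and> D a = Suc (D b)" and "z \<in> K"
  shows "\<exists>T' par' rk' str'. labelled_tree T' r par' rk' str' D \<and> T \<subseteq> T' \<and> T' \<subseteq> T \<union> K \<and> z \<in> T' \<and>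
    (\<forall>c\<in>T. par' c = par c)"
proof -
  have "\<exists>T' par' rk' str'. labelled_tree T' r par' rk' str' D \<and> T \<subseteq> T' \<and> T' \<subseteq> T \<union> {p \<in> K. D p \<le> n} \<and>
      z \<in> T' \<and>
    (\<forall>c\<in>T. par' c = par c)" if "z \<in> K" "D z = n" for n z
    using that
  proof (induction n arbitrary: z)
    \<comment> \<open>Label 0 does not occur in \<open>K\<close>, since \<open>descent\<close> makes
      every label there a successor.\<close>
    case 0
    then show ?case using descent by fastforce
  next
    case (Suc m)
    obtain b0 s where b0: "b0 \<in> K \<union> T" "D b0 = m" "s \<in> pverts G" "b0 \<in> S s" "(into (S s \<inter> K))\<^sup>*\<^sup>* b0 z"
      using descent[OF Suc.prems(1)] Suc.prems(2) by (auto simp: hop_def)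
    let ?L = "{p \<in> K. D p = Suc m}"
    \<comment> \<open>\<open>b\<close> is to be the last point of label \<open>m\<close> on the
      walk; it is found by going through the walk backwards from \<open>z\<close>.\<close>
    let ?good = "\<exists>b\<in>K \<union> T. b \<in> S s \<and> D b = m \<and> (into (S s \<inter> ?L))\<^sup>*\<^sup>* b z"
    define W where "W = (into (S s \<inter> K))\<^sup>*\<^sup>* b0"
    have "W b0 \<Longrightarrow> (D b0 = Suc m \<and> (into (S s \<inter> ?L))\<^sup>*\<^sup>* b0 z) \<or> ?good"
      using b0(5)
    proof (induction rule: converse_rtranclp_induct)
      case base
      then show ?case using Suc.prems by simp
    next
      case (step y w)
      have "W w" using step.prems step.hyps(1) unfolding W_def by (rule rtranclp.rtrancl_into_rtrancl)
      from step.IH[OF this] show ?case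
      proof
        assume w: "D w = Suc m \<and> (into (S s \<inter> ?L))\<^sup>*\<^sup>* w z"
        have "into (S s \<inter> ?L) y w" using step.hyps(1) w by (auto simp: into_def)
        then have yz: "(into (S s \<inter> ?L))\<^sup>*\<^sup>* y z" using w by (meson converse_rtranclp_into_rtranclp)
        show ?thesis
        proof (cases "y = b0")
          case True
          then show ?thesis using yz b0 by blast
        next
          case False
          then have y: "y \<in> S s" "y \<in> K" 
            using step.prems unfolding W_def by (metis IntD1 IntD2 into_def rtranclp.cases)+
          have "hop K b0 y" using step.prems b0 unfolding W_def hop_def by blast
          then have "D y \<le> Suc m" using lip b0 y unfolding lip_def by fastforce
          moreover have "hop K y z" using step.hyps b0(3) y
              by (auto simp: hop_def intro: converse_rtranclp_into_rtranclp)
          then have "Suc m \<le> D y + 1" using lip y Suc.prems unfolding lip_def by fastforce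
          ultimately have "D y = m \<or> D y = Suc m" by linarith
          then show ?thesis using yz y by blast
        qed
      qed blast
    qed
    then have ?good using b0(2) unfolding W_def by simp
    then obtain b where b: "b \<in> K \<union> T" "b \<in> S s" "D b = m" "(into (S s \<inter> ?L))\<^sup>*\<^sup>* b z" by blast
    have "\<exists>T' par' rk' str'. labelled_tree T' r par' rk' str' D \<and> T \<subseteq> T' \<and>
        T' \<subseteq> T \<union> {p \<in> K. D p \<le> m} \<and> b \<in> T' \<and>
      (\<forall>c\<in>T. par' c = par c)"
    proof (cases "b \<in> T")
      case True
      then show ?thesis using lt by blast
    next
      case False
      then show ?thesis using Suc.IH[of b] b by blast
    qed
    then obtain T1 par1 rk1 str1 where T1: "labelled_tree T1 r par1 rk1 str1 D" "T \<subseteq> T1"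
      "T1 \<subseteq> T \<union> {p \<in> K. D p \<le> m}" "b \<in> T1" "\<forall>c\<in>T. par1 c = par c" by blast
    have "?L \<inter> T1 = {}" using T1(3) disj by fastforce
    then have "\<exists>T' par' rk' str'. labelled_tree T' r par' rk' str' D \<and> T1 \<subseteq> T' \<and> T' \<subseteq> T1 \<union> ?L \<and> z \<in> T' \<and>
      (\<forall>c\<in>T1. par' c = par1 c)"
      by (rule grow_along_string[OF T1(1,4) b(3) b0(3) b(2,4)]) simp
    then obtain T' par' rk' str' where T': "labelled_tree T' r par' rk' str' D" "T1 \<subseteq> T'"
        "T' \<subseteq> T1 \<union> ?L" "z \<in> T'"
      "\<forall>c\<in>T1. par' c = par1 c" by (elim exE conjE)
    have "{p \<in> K. D p \<le> m} \<subseteq> {p \<in> K. D p \<le> Suc m}" "?L \<subseteq> {p \<in> K. D p \<le> Suc m}" by auto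
    then have "T' \<subseteq> T \<union> {p \<in> K. D p \<le> Suc m}" using T'(3) T1(3) by blast
    moreover have "\<forall>c\<in>T. par' c = par c" using T'(5) T1(2,5) by (simp add: subset_eq)
    ultimately show ?case using T'(1,4) order_trans[OF T1(2) T'(2)]
      by (intro exI[of _ T'] exI[of _ par'] exI[of _ rk'] exI[of _ str'] conjI)
  qed
  from this[OF assms(5) refl] show ?thesis by blast
qed

text \<open>An upper bound for the cost of coming from the tree: the label of the starting point
  plus one for each hop.\<close>

inductive reaches :: "point set \<Rightarrow> point set \<Rightarrow> (point \<Rightarrow> nat) \<Rightarrow> nat \<Rightarrow> point \<Rightarrow> bool" for K T D where
  base: "c \<in> T \<Longrightarrow> D c \<le> n \<Longrightarrow> reaches K T D n c"
| hop: "reaches K T D n b \<Longrightarrow> hop K b a \<Longrightarrow> a \<in> K \<Longrightarrow> reaches K T D (Suc n) a"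

lemma hop_sym: "hop K b a \<Longrightarrow> b \<in> K \<Longrightarrow> hop K a b"
  unfolding hop_def using into_sym into_end by (metis IntD1 IntI)

text \<open>Follow a chain of sets from \<open>a\<close> to the tree. Within one set the walk to the
  next common point either stays in \<open>K\<close>, or it leaves \<open>K\<close> at a tree point
  from which \<open>a\<close> is one hop away.\<close>

lemma reaches_exists:
  assumes disj: "K \<inter> T = {}" and exit: "\<And>b c. b \<in> K \<Longrightarrow> adj b c \<Longrightarrow> c \<notin> K \<Longrightarrow> c \<in> T"
    and t: "t \<in> T" "s \<in> pverts G" "t \<in> S s" and a: "a \<in> K" "v \<in> pverts G" "a \<in> S v"
  shows "\<exists>n. reaches K T D n a"
proof -
  have reach: "\<exists>n. reaches K T D n a"
    if v: "v \<in> pverts G" "p \<in> S v" and p: "p \<in> K \<Longrightarrow> \<exists>n. reaches K T D n p" and a: "a \<in> S v"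
        "a \<in> K" for v p a
  proof -
    have walk: "(into (S v))\<^sup>*\<^sup>* a p" using S_conn[OF v(1)] v(2) a(1)
        by (simp add: lattice_connected_def)
    have "a \<in> S v \<inter> K" using a by blast
    from into_exit[OF walk this] show ?thesis
    proof
      assume pK: "p \<in> K \<and> (into (S v \<inter> K))\<^sup>*\<^sup>* a p"
      then have "hop K a p" using a v by (auto simp: hop_def)
      then have "hop K p a" using a hop_sym by blast
      then show ?thesis using p pK a reaches.hop by blast
    next
      assume "\<exists>c b. c \<in> S v - K \<and> b \<in> S v \<inter> K \<and> adj b c \<and> (into (S v \<inter> K))\<^sup>*\<^sup>* c a"
      then obtain c b where c: "c \<in> S v" "c \<notin> K" "b \<in> K" "adj b c" "(into (S v \<inter> K))\<^sup>*\<^sup>* c a" by blast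
      then have "hop K c a" using v by (auto simp: hop_def)
      moreover have "reaches K T D (D c) c" using exit c by (intro reaches.base) auto
      ultimately show ?thesis using a reaches.hop by blast
    qed
  qed
  have "v \<in> pverts G \<Longrightarrow> \<forall>a\<in>S v \<inter> K. \<exists>n. reaches K T D n a"
    using linked[OF a(2) t(2)]
  proof (induction rule: converse_rtranclp_induct)
    case base
    have "t \<notin> K" using t disj by blast
    then show ?case using reach[OF t(2,3)] by blast
  next
    case (step y w)
    have w: "w \<in> pverts G" using step_pverts step by blast
    obtain p where p: "p \<in> S y" "p \<in> S w" using S_step[OF step.prems w] step.hyps by blast
    then have "p \<in> K \<Longrightarrow> \<exists>n. reaches K T D n p" using step.IH[OF w] by blast
    then show ?case using reach[OF step.prems p(1)] by blast
  qed
  then show ?thesis using a by blast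
qed

text \<open>The least cost is the McShane extension of the labels on \<open>T\<close>, the largest
  one that is 1-Lipschitz. Unlike the given \<open>D0\<close> it has a predecessor for every point
  of \<open>K\<close>, as a greedy path requires.\<close>

lemma max_extension:
  assumes lip: "lip K T D0" and disj: "K \<inter> T = {}" and ex: "\<And>a. a \<in> K \<Longrightarrow> \<exists>n. reaches K T D0 n a"
  shows "\<exists>D. (\<forall>c\<in>T. D c = D0 c) \<and> lip K T D \<and> (\<forall>a\<in>K. \<exists>b\<in>K \<union> T. hop K b a \<and> D a = Suc (D b))"
proof -
  define D where "D a = (LEAST n. reaches K T D0 n a)" for a
  have in_KT: "a \<in> K \<union> T" if "reaches K T D0 n a" for n a using that by cases auto
  have low: "D0 a \<le> n" if "reaches K T D0 n a" for n a
    using that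
  proof induction
    case (hop n b a)
    then have "D0 a \<le> D0 b + 1" using lip in_KT unfolding lip_def by blast
    then show ?case using hop by simp
  qed
  have DT: "D c = D0 c" if "c \<in> T" for c
    unfolding D_def using that low by (intro Least_equality) (auto intro: reaches.base)
  have wD: "reaches K T D0 (D a) a" if "a \<in> K \<union> T" for a
  proof -
    have "\<exists>n. reaches K T D0 n a" using that ex reaches.base by blast
    then show ?thesis unfolding D_def by (rule LeastI_ex)
  qed
  have le: "D a \<le> n" if "reaches K T D0 n a" for n a unfolding D_def using that by (rule Least_le)
  have hop_le: "D a \<le> D b + 1" if "b \<in> K \<union> T" "a \<in> K" "hop K b a" for a b
    using le[OF reaches.hop[OF wD[OF that(1)] that(3,2)]] by simp
  have "D b \<le> D a + 1" if "b \<in> K \<union> T" "a \<in> K" "hop K b a" for a b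
  proof (cases "b \<in> K")
    case True
    then show ?thesis using hop_le[of a b] hop_sym that by blast
  next
    \<comment> \<open>The hop from a tree point \<open>b\<close> cannot be reversed. Here
      \<open>D0\<close> mediates: being Lipschitz on the territory, it bounds the cost from below
      and keeps the neighbours of \<open>b\<close> from becoming too cheap.\<close>
    case False
    then have "D b = D0 b" using that DT by blast
    also have "\<dots> \<le> D0 a + 1" using lip that unfolding lip_def by blast
    also have "\<dots> \<le> D a + 1" using low wD that by simp
    finally show ?thesis .
  qed
  then have "lip K T D" unfolding lip_def using hop_le by blast
  moreover have "\<exists>b\<in>K \<union> T. hop K b a \<and> D a = Suc (D b)" if a: "a \<in> K" for a
  proof -
    have "reaches K T D0 (D a) a" using wD a by blast
    then show ?thesis
    proof cases
      case base
      then show ?thesis using a disj by blast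
    next
      case (hop n b)
      have b: "b \<in> K \<union> T" using in_KT hop(2) .
      have "D b = n" using le[OF hop(2)] hop_le[OF b a hop(3)] hop(1) by simp
      then show ?thesis using b hop by blast
    qed
  qed
  ultimately show ?thesis using DT by (intro exI[of _ D]) simp
qed

end

section \<open>Shrinking the territory\<close>

context string_system
begin

text \<open>The common stretch of the two tree paths cancels in the cycle and may run inside the
  disc; therefore the territory is \<open>inner A - T\<close>, not \<open>inner A\<close>.\<close>

definition enclosure ::
  "triangle set \<Rightarrow> point \<Rightarrow> point \<Rightarrow> edge \<Rightarrow> point set \<Rightarrow> point \<Rightarrow> (point \<Rightarrow> point) \<Rightarrow> (point \<Rightarrow> nat) \<Rightarrow>
    (point \<Rightarrow> 'a) \<Rightarrow> (point \<Rightarrow> nat) \<Rightarrow> bool" where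
  "enclosure A x y e T r par rk str D \<longleftrightarrow> labelled_tree T r par rk str D \<and> x \<in> T \<and> y \<in> T \<and>
    T = anc par r x \<union> anc par r y \<and> ends e = {x, y} \<and> finite A \<and> bd A = fund_cycle par r x y e \<and>
    lip (inner A - T) T D \<and> inner A \<subseteq> (\<Union>v\<in>pverts G. S v)"

lemma enclosure_bd_ends:
  assumes "enclosure A x y e T r par rk str D" "e' \<in> bd A"
  shows "ends e' \<subseteq> T"
  using assms fund_cycle_ends[of e' par r x y e] unfolding enclosure_def by blast

lemma enclosure_exit:
  assumes "enclosure A x y e T r par rk str D" "b \<in> inner A - T" "adj b c" "c \<notin> inner A - T"
  shows "c \<in> T"
  using inner_adj[of b A c T] assms enclosure_bd_ends[OF assms(1)] by blast

text \<open>The third path \<open>anc z\<close> meets the old ones only where it merges with them, so the robber ends up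
  in one of the two parts and the path that does not border that part can be released.\<close>

lemma enclosure_part:
  assumes enc: "enclosure A x y e T r par rk str D"
    and T': "tree T' r par' rk'" "labelled_tree T' r par' rk' str' D'" "T \<subseteq> T'" "T' \<subseteq> T \<union> (inner A - T)"
      "z \<in> T'" "\<forall>c\<in>T. par' c = par c"
    and lip: "lip (inner A - T) T D'"
    and B: "finite B" "bd B = fund_cycle par' r x z f" "ends f = {x, z}" "B \<subseteq> A"
    and t: "y \<in> corners t" "t \<notin> B"
  defines "U \<equiv> anc par' r x \<union> anc par' r z"
  shows "enclosure B x z f U r par' rk' str' D'" "inner B - U \<subseteq> inner A - T"
proof -
  have xy: "x \<in> T" "y \<in> T" and T: "tree T r par rk" and TT: "T = anc par r x \<union> anc par r y"
    using enc unfolding enclosure_def labelled_tree_def by blast+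
  have ancx: "anc par' r x = anc par r x" by (rule anc_cong[OF T xy(1)]) (rule bspec[OF T'(6)])
  have ancy: "anc par' r y = anc par r y" by (rule anc_cong[OF T xy(2)]) (rule bspec[OF T'(6)])
  have U_sub: "U \<subseteq> T'" using anc_subset[OF T'(1)] xy T'(3,5) unfolding U_def by blast
  have bdB: "ends e' \<subseteq> U" if "e' \<in> bd B" for e'
    using fund_cycle_ends[of e' par' r x z f] that B(2,3) unfolding U_def by blast
  \<comment> \<open>The path from \<open>y\<close> that is dropped starts outside
    \<open>inner B\<close>, since \<open>y\<close> is a corner of \<open>t\<close>. It can enter
    \<open>inner B\<close> only through \<open>U\<close>, and once in \<open>U\<close> it stays
    there.\<close>
  have "c \<in> U \<or> c \<notin> inner B" if "c \<in> anc par' r y" for c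
    using that
  proof induction
    case self
    then show ?case using t unfolding inner_def by blast
  next
    case (up c)
    show ?case
    proof (rule ccontr)
      assume "\<not> (par' c \<in> U \<or> par' c \<notin> inner B)"
      then have 1: "par' c \<notin> U" "par' c \<in> inner B" by blast+
      have "c \<notin> U" using 1(1) anc.up[OF _ up.hyps(2), of par'] unfolding U_def by blast
      moreover have "c \<in> T'" using up.hyps(1) anc_subset[OF T'(1)] xy T'(3) by blast
      then have "adj (par' c) c" using tree_par(2)[OF T'(1) _ up.hyps(2)] adj_sym by blast
      ultimately have "c \<in> inner B" using inner_adj[OF 1(2)] bdB by blast
      then show False using up.IH \<open>c \<notin> U\<close> by blast
    qed
  qed
  moreover have AB: "inner B \<subseteq> inner A" using B(4) unfolding inner_def by blast
  ultimately show sub: "inner B - U \<subseteq> inner A - T" using TT ancx ancy unfolding U_def by blast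
  have "labelled_tree U r par' rk' str' D'"
  proof (rule labelled_tree_subset[OF T'(2) U_sub])
    show "r \<in> U" using root_in_anc[OF T'(1) T'(5)] unfolding U_def by blast
  qed (auto simp: U_def intro: anc.up)
  moreover have "lip (inner B - U) U D'" using lip_mono[OF lip sub] U_sub T'(4) by blast
  ultimately show "enclosure B x z f U r par' rk' str' D'"
    using enc B AB unfolding enclosure_def U_def by (auto intro: anc.self)
qed

text \<open>Induction on the number of triangles. The guards of the two paths have label functions
  \<open>Dx\<close> and \<open>Dy\<close> of their own, as these stem from different stages;
  \<open>D\<close> is the latest one and the one to be extended.\<close>

lemma enclosure_wins:
  assumes "enclosure A x y e T r par rk str D"
    and "guard (inner A - T) (anc par r x) P Dx" "guard (inner A - T) (anc par r y) Q Dy"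
    and "u \<in> pverts G" "S u \<subseteq> inner A - T" "length C = 4" "set C \<subseteq> pverts G"
  shows "flees (posts P Dx u @ posts Q Dy u @ C) u"
  using assms
proof (induction "card A" arbitrary: A x y e T par rk str D P Dx Q Dy u C rule: less_induct)
  case less
  note enc = less.prems(1) and Pg = less.prems(2) and Qg = less.prems(3)
  define K where "K = inner A - T"
  have lt: "labelled_tree T r par rk str D" and xy: "x \<in> T"
      "y \<in> T" and TT: "T = anc par r x \<union> anc par r y"
    and e: "ends e = {x, y}" and A: "finite A" "bd A = fund_cycle par r x y e" and lipK: "lip K T D"
    and cover: "inner A \<subseteq> (\<Union>v\<in>pverts G. S v)"
    using enc unfolding enclosure_def K_def by blast+
  have T: "tree T r par rk" using lt by (simp add: labelled_tree_def)
  have disj: "K \<inter> T = {}" by (auto simp: K_def)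
  have exit: "c \<in> T" if "b \<in> K" "adj b c" "c \<notin> K" for b c
    using enclosure_exit[OF enc] that unfolding K_def by blast
  obtain t where t: "t = side1 e \<or> t = side2 e" "t \<in> A"
  proof -
    have "A \<noteq> {}"
    proof
      assume "A = {}"
      then have "inner A = {}" using some_triangle unfolding inner_def by blast
      then show False using S_ne less.prems(4,5) by blast
    qed
    \<comment> \<open>For a tree edge the cycle, and with it \<open>A\<close>, would be empty. So
      \<open>e\<close> really lies on the boundary and has a side in \<open>A\<close>.\<close>
    then have "e \<notin> tree_edges T r par"
      using fund_cycle_tree_edge[OF T xy e] bd_empty_imp_empty[OF A(1)] A(2) by blast
    then have "e \<in> bd A"
      using path_edges_subset[OF T xy(1)] path_edges_subset[OF T xy(2)]
          unfolding A(2) fund_cycle_def by blast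
    then show ?thesis using that unfolding bd_def by blast
  qed
  obtain z f g where z: "corners t = {x, y, z}" "ends f = {x, z}" "ends g = {y, z}" "z \<noteq> x" "z \<noteq> y"
      "x \<noteq> y"
    "{e'. side1 e' = t \<or> side2 e' = t} = {e, f, g}"
    by (rule third_corner[OF t(1) e])
  have zKT: "z \<in> K \<union> T"
    using innerI[of z t A T] z(1) t(2) enclosure_bd_ends[OF enc] unfolding K_def by blast
  have ex: "\<exists>n. reaches K T D n a" if a: "a \<in> K" for a
  proof -
    obtain v where v: "v \<in> pverts G" "a \<in> S v" using a cover unfolding K_def by blast
    have sx: "str x \<in> pverts G" "x \<in> S (str x)" using lt xy by (simp_all add: labelled_tree_def)
    show ?thesis by (rule reaches_exists[OF disj _ xy(1) sx a v]) (rule exit)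
  qed
  have "\<exists>E. (\<forall>c\<in>T. E c = D c) \<and> lip K T E \<and> (\<forall>a\<in>K. \<exists>b\<in>K \<union> T. hop K b a \<and> E a = Suc (E b))"
    by (rule max_extension[OF lipK disj]) (rule ex)
  then obtain E where E: "\<forall>c\<in>T. E c = D c" "lip K T E"
    and descent: "\<forall>a\<in>K. \<exists>b\<in>K \<union> T. hop K b a \<and> E a = Suc (E b)"
    by (elim exE conjE)
  have ltE: "labelled_tree T r par rk str E"
  proof -
    have "par c \<in> T" if "c \<in> T - {r}" for c using tree_par[OF T] that by blast
    moreover have "r \<in> T" using T by (simp add: tree_def)
    ultimately show ?thesis using lt E(1) unfolding labelled_tree_def by simp
  qed
  have "\<exists>T' par' rk' str'. labelled_tree T' r par' rk' str' E \<and> T \<subseteq> T' \<and> T' \<subseteq> T \<union> K \<and> z \<in> T' \<and>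
    (\<forall>c\<in>T. par' c = par c)"
  proof (cases "z \<in> T")
    \<comment> \<open>Nothing has to be grown: the existing tree path of \<open>z\<close> is the
      third path.\<close>
    case True
    then show ?thesis using ltE by blast
  next
    case False
    then have "z \<in> K" using zKT by blast
    show ?thesis by (rule grow_tree[OF ltE E(2) disj _ \<open>z \<in> K\<close>]) (rule bspec[OF descent])
  qed
  then obtain T' par' rk' str' where T': "labelled_tree T' r par' rk' str' E" "T \<subseteq> T'" "T' \<subseteq> T \<union> K"
      "z \<in> T'"
    and par': "\<forall>c\<in>T. par' c = par c" by (elim exE conjE)
  have tT': "tree T' r par' rk'" using T' by (simp add: labelled_tree_def)
  have xy': "x \<in> T'" "y \<in> T'" using xy T'(2) by blast+
  have parc: "par' c = par c" if "c \<in> T" for c using par' that by (rule bspec)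
  have ancx: "anc par' r x = anc par r x" by (rule anc_cong[OF T xy(1)]) (rule parc)
  have ancy: "anc par' r y = anc par r y" by (rule anc_cong[OF T xy(2)]) (rule parc)
  have "path_edges par' r x = path_edges par r x" by (rule path_edges_cong[OF T xy(1)]) (rule parc)
  moreover have "path_edges par' r y = path_edges par r y"
      by (rule path_edges_cong[OF T xy(2)]) (rule parc)
  ultimately have bdA: "bd A = fund_cycle par' r x y e" using A(2) by (simp only: fund_cycle_def)
  obtain B1 B2 where B: "finite B1" "finite B2" "bd B1 = fund_cycle par' r x z f"
      "bd B2 = fund_cycle par' r y z g"
    "A - {t} = B1 \<union> B2" "B1 \<inter> B2 = {}" "t \<notin> B1" "t \<notin> B2"
    by (rule theta_split[OF tT' xy' T'(4) e z(2-7) A(1) bdA t(2)])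
  have "lip K T' E" using lip_mono[OF E(2) order_refl] T'(3) by blast
  then obtain R where R: "guard K (anc par' r z) R E"
    using labelled_tree_guard[OF T'(1) _ T'(4)] by metis
  have BA: "B1 \<subseteq> A" "B2 \<subseteq> A" "B1 \<noteq> A" "B2 \<noteq> A" using B(5,7,8) t(2) by blast+
  then have card: "card B1 < card A" "card B2 < card A"
    using A(1) psubset_card_mono by blast+
  have lipE: "lip (inner A - T) T E" using E(2) by (simp add: K_def)
  have T'K: "T' \<subseteq> T \<union> (inner A - T)" using T'(3) by (simp add: K_def)
  have xt: "x \<in> corners t" and yt: "y \<in> corners t" by (simp_all add: z(1))
  \<comment> \<open>Exchanging \<open>x\<close> and \<open>y\<close> makes
    \<open>enclosure_part\<close> applicable to the second half.\<close>
  have fc: "fund_cycle par r y x e = fund_cycle par r x y e" unfolding fund_cycle_def by blast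
  have enc': "enclosure A y x e T r par rk str D"
    using enc
    unfolding enclosure_def fc insert_commute[of y x "{}"] Un_commute[of "anc par r y" "anc par r x"]
    by blast
  let ?U1 = "anc par' r x \<union> anc par' r z" and ?U2 = "anc par' r y \<union> anc par' r z"
  note enc1 = enclosure_part[OF enc tT' T'(1,2) T'K T'(4) par' lipE B(1,3) z(2) BA(1) yt B(7),
      folded K_def]
  note enc2 = enclosure_part[OF enc' tT' T'(1,2) T'K T'(4) par' lipE B(2,4) z(3) BA(2) xt B(8),
      folded K_def]
  interpret two_guards G S K "anc par r x" "anc par r y" P Q Dx Dy
  proof
    show "guard K (anc par r x) P Dx" "guard K (anc par r y) Q Dy" using Pg Qg by (simp_all add: K_def)
    show "c \<in> anc par r x \<union> anc par r y" if "b \<in> K" "adj b c" "c \<notin> K" for b c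
      using exit[OF that] TT by simp
  qed
  show ?case
  proof (rule third_guard[OF R])
    show "anc par' r z \<subseteq> K \<union> anc par r x \<union> anc par r y" using anc_subset[OF tT' T'(4)] T'(3) TT by blast
    fix w assume w: "w \<in> pverts G" "S w \<subseteq> K" "S w \<inter> anc par' r z = {}"
    have wT: "S w \<inter> T = {}" using w(2) disj by blast
    have wU: "S w \<inter> ?U1 = {}" "S w \<inter> ?U2 = {}" using wT w(3) TT ancx ancy by blast+
    obtain a where a: "a \<in> S w" using S_ne[OF w(1)] by blast
    obtain t0 where t0: "a \<in> corners t0" using some_triangle by blast
    have walk: "(into (S w))\<^sup>*\<^sup>* a b" if "b \<in> S w" for b
      using S_conn[OF w(1)] a that by (simp add: lattice_connected_def)
    have len: "length (posts P D u) = 4" for P D u by (simp add: posts_def)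
    have bdU1: "ends e' \<subseteq> ?U1" if "e' \<in> bd B1" for e' using enclosure_bd_ends[OF enc1(1) that] .
    have bdU2: "ends e' \<subseteq> ?U2" if "e' \<in> bd B2" for e' using enclosure_bd_ends[OF enc2(1) that] .
    have "a \<notin> T" using a wT by blast
    \<comment> \<open>All three corners of \<open>t\<close> are guarded, so the triangle at an
      unguarded point lies in one of the two parts.\<close>
    have "t0 \<noteq> t"
    proof
      assume "t0 = t"
      then have "a = z" using t0 z(1) xy \<open>a \<notin> T\<close> by auto
      then show False using a w(3) anc.self by blast
    qed
    moreover have "a \<in> inner A" using a w(2) unfolding K_def by blast
    then have "t0 \<in> A" using t0 unfolding inner_def by blast
    ultimately consider "t0 \<in> B1" | "t0 \<in> B2" using B(5) by blast
    then show "flees (posts P Dx w @ posts Q Dy w @ posts R E w) w"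
    proof cases
      case 1
      have aU: "a \<notin> ?U1" using a wU(1) by blast
      have aB: "a \<in> inner B1" by (rule innerI[OF t0 1 aU]) (rule bdU1)
      have sub: "S w \<subseteq> inner B1 - ?U1"
      proof
        fix b assume b: "b \<in> S w"
        have "b \<in> inner B1" by (rule inner_connected[OF walk[OF b] aB wU(1)]) (rule bdU1)
        then show "b \<in> inner B1 - ?U1" using b wU(1) by blast
      qed
      have "guard (inner B1 - ?U1) (anc par' r x) P Dx" using guard_mono[OF P enc1(2)] ancx by simp
      \<comment> \<open>The path of \<open>y\<close> is released: its four cops become the free
        group for the smaller disc, and \<open>flees_mset\<close> puts the groups in order.\<close>
      from less.hyps[OF card(1) enc1(1) this guard_mono[OF R enc1(2)] w(1) sub len posts_pverts[OF Q]]
      show ?thesis by (rule flees_mset) simp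
    next
      case 2
      have aU: "a \<notin> ?U2" using a wU(2) by blast
      have aB: "a \<in> inner B2" by (rule innerI[OF t0 2 aU]) (rule bdU2)
      have sub: "S w \<subseteq> inner B2 - ?U2"
      proof
        fix b assume b: "b \<in> S w"
        have "b \<in> inner B2" by (rule inner_connected[OF walk[OF b] aB wU(2)]) (rule bdU2)
        then show "b \<in> inner B2 - ?U2" using b wU(2) by blast
      qed
      have "guard (inner B2 - ?U2) (anc par' r y) Q Dy" using guard_mono[OF Q enc2(2)] ancy by simp
      from less.hyps[OF card(2) enc2(1) this guard_mono[OF R enc2(2)] w(1) sub len posts_pverts[OF P]]
      show ?thesis by (rule flees_mset) simp
    qed
  qed (use less.prems in \<open>simp_all add: K_def\<close>)
qed

end

section \<open>The initial position\<close>

definition box :: "int \<Rightarrow> point set" where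
  "box N = {0..N} \<times> {0..N}"

definition frame :: "int \<Rightarrow> point set" where
  "frame N = {(a, b). (a, b) \<in> box N \<and> (a = 0 \<or> a = N \<or> b = 0 \<or> b = N)}"

definition box_triangles :: "int \<Rightarrow> triangle set" where
  "box_triangles N = UNIV \<times> {0..<N} \<times> {0..<N}"

text \<open>The frame is a path from \<open>(0, 1)\<close> to the root \<open>(0, 0)\<close>; the value at the root is irrelevant.\<close>

fun frame_par :: "int \<Rightarrow> point \<Rightarrow> point" where
  "frame_par N (a, b) = (if b = 0 \<and> 0 < a then (a - 1, b) else if a = N \<and> 0 < b then (a, b - 1)
    else if b = N \<and> a < N then (a + 1, b) else (a, b + 1))"

text \<open>The number of steps from the root along the bottom, right, top and left side.\<close>

fun frame_rank :: "int \<Rightarrow> point \<Rightarrow> nat" where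
  "frame_rank N (a, b) = nat (if b = 0 then a else if a = N then N + b else
      if b = N then 3 * N - a else 4 * N - b)"

lemma adj_Hor: "adj (a, b) (a + 1, b)" and adj_Ver: "adj (a, b) (a, b + 1)"
  unfolding adj_def by (rule exI[of _ "(Hor, a, b)"], simp) (rule exI[of _ "(Ver, a, b)"], simp)

lemma adj_frame_par: "adj p (frame_par N p)"
proof -
  obtain a b where p: "p = (a, b)" by (cases p)
  show ?thesis
    using adj_sym[OF adj_Hor[of "a - 1" b]] adj_sym[OF adj_Ver[of a
        "b - 1"]] adj_Hor[of a b] adj_Ver[of a b]
    unfolding p frame_par.simps by (smt (verit))
qed

lemma tree_frame:
  assumes "1 \<le> N"
  shows "tree (frame N) (0, 0) (frame_par N) (frame_rank N)"
proof -
  have "finite (frame N)" by (rule finite_subset[of _ "box N"]) (auto simp: frame_def box_def)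
  moreover have "frame_par N c \<in> frame N \<and> frame_rank N (frame_par N c) < frame_rank N c"
    if cf: "c \<in> frame N" "c \<noteq> (0, 0)" for c
  proof -
    obtain a b where c: "c = (a, b)" by (cases c)
    have ab: "0 \<le> a" "a \<le> N" "0 \<le> b" "b \<le> N" using cf(1) by (simp_all add: c frame_def box_def)
    consider "b = 0" "0 < a" | "a = N" "0 < b" | "b = N" "a < N" | "a = 0" "0 < b" "b < N"
    proof -
      have "a = 0 \<or> a = N \<or> b = 0 \<or> b = N" "a \<noteq> 0 \<or> b \<noteq> 0" using cf by (auto simp: c frame_def)
      then have "b = 0 \<and> 0 < a \<or> a = N \<and> 0 < b \<or> b = N \<and> a < N \<or> a = 0 \<and> 0 < b \<and> b < N"
        using ab assms by arith
      then show ?thesis using that by blast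
    qed
    then show ?thesis
      by cases (use ab assms in \<open>simp_all add: c frame_def box_def\<close>)
  qed
  moreover have "(0, 0) \<in> frame N" using assms by (simp add: frame_def box_def)
  ultimately show ?thesis using adj_frame_par unfolding tree_def by blast
qed

lemma anc_frame:
  assumes N: "1 \<le> N"
  shows "anc (frame_par N) (0, 0) (0, 1) = frame N"
proof
  show "anc (frame_par N) (0, 0) (0, 1) \<subseteq> frame N"
    using N by (intro anc_subset[OF tree_frame[OF N]]) (auto simp: frame_def box_def)
  have "c \<in> anc (frame_par N) (0, 0) (0, 1)" if "c \<in> frame N" for c
    using that
  proof (induction "nat (4 * N) - frame_rank N c" arbitrary: c rule: less_induct)
    case less
    obtain a b where c: "c = (a, b)" by (cases c)
    show ?case
    proof (cases "c = (0, 1)")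
      case True
      then show ?thesis by (simp add: anc.self)
    next
      case False
      \<comment> \<open>The point before \<open>c\<close> on the way from \<open>(0, 1)\<close>,
        that is, the one whose parent is \<open>c\<close>.\<close>
      define d where "d = (if b = 0 \<and> a < N then (a + 1, b) else if a = N \<and> b < N then (a, b + 1)
        else if b = N \<and> 0 < a then (a - 1, b) else (a, b - 1))"
      have ab: "0 \<le> a" "a \<le> N" "0 \<le> b" "b \<le> N" using less.prems by (simp_all add: c frame_def box_def)
      consider "b = 0" "a < N" | "a = N" "b < N" | "b = N" "0 < a" | "a = 0" "1 < b"
      proof -
        have "a = 0 \<or> a = N \<or> b = 0 \<or> b = N" "a \<noteq> 0 \<or> b \<noteq> 1"
          using less.prems False by (auto simp: c frame_def)
        then have "b = 0 \<and> a < N \<or> a = N \<and> b < N \<or> b = N \<and> 0 < a \<or> a = 0 \<and> 1 < b"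
          using ab N by arith
        then show ?thesis using that by blast
      qed
      then have d: "d \<in> frame N \<and> d \<noteq> (0, 0) \<and> frame_par N d = c \<and> frame_rank N c < frame_rank N d \<and>
        frame_rank N c < nat (4 * N)"
        by cases (use ab N in \<open>simp_all add: c d_def frame_def box_def\<close>)
      then have "d \<in> anc (frame_par N) (0, 0) (0, 1)" by (intro less.hyps diff_less_mono2) simp_all
      then show ?thesis using anc.up[of d "frame_par N" "(0, 0)" "(0, 1)"] d by simp
    qed
  qed
  then show "frame N \<subseteq> anc (frame_par N) (0, 0) (0, 1)" by blast
qed

text \<open>The boundary of the square is a cycle made of tree edges and the one missing edge
  \<open>(Ver, 0, 0)\<close>, so it can be identified without computing the tree paths.\<close>

lemma bd_box_triangles:
  assumes N: "1 \<le> N"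
  shows "bd (box_triangles N) = fund_cycle (frame_par N) (0, 0) (0, 0) (0, 1) (Ver, 0, 0)"
proof (rule cycle_eq_fund_cycle[OF tree_frame[OF N]])
  show "(0, 0) \<in> frame N" "(0, 1) \<in> frame N" using N by (auto simp: frame_def box_def)
  show "ends (Ver, 0, 0) = {(0, 0), (0, 1)}" by simp
  show "odd_points (bd (box_triangles N)) = {}" by (rule odd_points_bd) (simp add: box_triangles_def)
  show "(Ver, 0, 0) \<in> bd (box_triangles N)" using N by (auto simp: bd_def box_triangles_def)
  show "(Ver, 0, 0) \<notin> tree_edges (frame N) (0, 0) (frame_par N)"
  proof
    assume "(Ver, 0, 0) \<in> tree_edges (frame N) (0, 0) (frame_par N)"
    then obtain c where "c \<noteq> (0, 0)" "ends (Ver, 0, 0) = {c, frame_par N c}"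
      unfolding tree_edges_def by blast
    then have "c \<noteq> (0, 0)" "{(0, 0), (0, 1)} = {c, frame_par N c}" by simp_all
    then have "(0, 1) = c \<and> (0, 0) = frame_par N c" unfolding doubleton_eq_iff by blast
    then have "c = (0, 1)" "frame_par N c = (0, 0)" by simp_all
    then show False using N by (simp split: if_splits)
  qed
  have "(k, a, b) \<in> insert (Ver, 0, 0) (tree_edges (frame N) (0, 0) (frame_par N))"
    if "(k, a, b) \<in> bd (box_triangles N)" for k a b
  proof (cases k)
    case Hor
    then have "0 \<le> a" "a < N" "b = 0 \<or> b = N" using that by (auto simp: bd_def box_triangles_def)
    then show ?thesis
    proof (elim disjE)
      assume "b = 0"
      then show ?thesis using \<open>0 \<le> a\<close> \<open>a < N\<close> Hor
        by (intro insertI2) (auto simp: tree_edges_def frame_def box_def intro!: bexI[of _ "(a + 1, b)"])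
    next
      assume "b = N"
      then show ?thesis using \<open>0 \<le> a\<close> \<open>a < N\<close> Hor N
        by (intro insertI2) (auto simp: tree_edges_def frame_def box_def intro!: bexI[of _ "(a, b)"])
    qed
  next
    case Ver
    then have "0 \<le> b" "b < N" "a = 0 \<or> a = N" using that by (auto simp: bd_def box_triangles_def)
    then show ?thesis
    proof (elim disjE)
      assume "a = 0"
      then show ?thesis using \<open>0 \<le> b\<close> \<open>b < N\<close> Ver N
        by (cases "b = 0") (auto simp: tree_edges_def frame_def box_def intro!: bexI[of _ "(a, b)"])
    next
      assume "a = N"
      then show ?thesis using \<open>0 \<le> b\<close> \<open>b < N\<close> Ver N
        by (intro insertI2) (auto simp: tree_edges_def frame_def box_def intro!: bexI[of _ "(a, b + 1)"])
    qed
  next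
    case Dia
    then show ?thesis using that by (auto simp: bd_def box_triangles_def)
  qed
  then show "bd (box_triangles N) \<subseteq> insert (Ver, 0, 0) (tree_edges (frame N) (0, 0) (frame_par N))"
    by (intro subsetI) (metis surj_pair)
qed

lemma inner_box_triangles: "inner (box_triangles N) \<subseteq> box N"
proof
  fix p assume p: "p \<in> inner (box_triangles N)"
  obtain a b where ab: "p = (a, b)" by (cases p)
  have "p \<in> corners (False, a, b)" using ab by simp
  then have "(False, a, b) \<in> box_triangles N" using p unfolding inner_def by blast
  then show "p \<in> box N" by (auto simp: ab box_triangles_def box_def)
qed

lemma interior_subset_inner: "box N - frame N \<subseteq> inner (box_triangles N)"
proof
  fix p assume p: "p \<in> box N - frame N"
  obtain a b where ab: "p = (a, b)" by (cases p)
  have "(l, c, d) \<in> box_triangles N" if "p \<in> corners (l, c, d)" for l c d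
    using that p by (cases l) (auto simp: ab box_triangles_def box_def frame_def)
  then show "p \<in> inner (box_triangles N)" unfolding inner_def by auto
qed

context string_system
begin

text \<open>The frame belongs to \<open>v0\<close>, so the one-vertex walk \<open>[v0]\<close> with
  constant label 0 guards both initial paths; the path of \<open>x\<close> is just the root. Twelve
  cops on \<open>v0\<close> are two groups in place and a free one.\<close>

lemma cops_suffice_12:
  assumes N: "1 \<le> N" and v0: "v0 \<in> pverts G" "frame N \<subseteq> S v0" and cover: "(\<Union>v\<in>pverts G. S v) = box N"
  shows "cops_suffice G 12"
proof (rule cops_suffice_if_winning[OF graph])
  let ?A = "box_triangles N" and ?C = "replicate 12 v0"
  show "placement G 12 ?C" using v0 by (auto simp: placement_def)
  fix u assume u: "u \<in> pverts G"
  have T: "tree (frame N) (0, 0) (frame_par N) (frame_rank N)" by (rule tree_frame[OF N])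
  have corner: "(0, 0) \<in> frame N" "(0, 1) \<in> frame N" using N by (auto simp: frame_def box_def)
  have lip: "lip K X (\<lambda>_. 0)" for K X by (simp add: lip_def)
  have guard: "guard K X [v0] (\<lambda>_. 0)" if "X \<subseteq> frame N" for K X
    using that v0 lip unfolding guard_def by auto
  have posts: "posts [v0] (\<lambda>_. 0) u = replicate 4 v0"
    by (simp add: posts_def target_def numeral_eq_Suc)
  show "winning G ?C u"
  proof (cases "step G v0 u")
    case True
    then show ?thesis by (intro winning_catch[OF finite_parcs, of v0]) simp_all
  next
    case False
    then have "S u \<inter> frame N = {}" using S_step[OF v0(1) u] v0(2) by blast
    moreover have "S u \<subseteq> box N" using cover u by blast
    ultimately have Su: "S u \<subseteq> inner ?A - frame N" using interior_subset_inner by blast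
    have "labelled_tree (frame N) (0, 0) (frame_par N) (frame_rank N) (\<lambda>_. v0) (\<lambda>_. 0)"
      using T v0 unfolding labelled_tree_def by auto
    moreover have "frame N = anc (frame_par N) (0, 0) (0, 0) \<union> anc (frame_par N) (0, 0) (0, 1)"
      using corner by (auto simp: anc_frame[OF N] anc_root)
    ultimately have enc: "enclosure ?A (0, 0) (0, 1) (Ver, 0, 0) (frame N) (0,
        0) (frame_par N) (frame_rank N)
        (\<lambda>_. v0) (\<lambda>_. 0)"
      using corner bd_box_triangles[OF N] lip inner_box_triangles[of N] cover
      unfolding enclosure_def by (simp add: box_triangles_def)
    have "flees (posts [v0] (\<lambda>_. 0) u @ posts [v0] (\<lambda>_. 0) u @ replicate 4 v0) u"
      using v0 by (intro enclosure_wins[OF enc guard guard u Su] anc_subset[OF T] corner) simp_all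
    then have "flees ?C u" unfolding posts by (simp add: replicate_add[symmetric])
    moreover have "list_all2 (step G) ?C ?C" by (simp add: list_all2_same step_refl)
    ultimately show ?thesis by (rule winningI[rotated])
  qed
qed

end

section \<open>From curves to lattice sets\<close>

lemma lattice_connectedI:
  assumes "b \<in> X" "\<And>p. p \<in> X \<Longrightarrow> (into X)\<^sup>*\<^sup>* b p"
  shows "lattice_connected X"
  unfolding lattice_connected_def
proof (intro ballI)
  fix p q assume "p \<in> X" "q \<in> X"
  then show "(into X)\<^sup>*\<^sup>* p q"
    using into_sym[OF assms(2) assms(1)] assms(2) rtranclp_trans[of "into X" p b q] by blast
qed

lemma lattice_connected_Un:
  assumes X: "lattice_connected X" "b \<in> X" and Y: "lattice_connected Y" "c \<in> Y" and "b = c \<or> adj b c"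
  shows "lattice_connected (X \<union> Y)"
proof (rule lattice_connectedI)
  show "b \<in> X \<union> Y" using X by blast
  fix p assume p: "p \<in> X \<union> Y"
  have bc: "(into (X \<union> Y))\<^sup>*\<^sup>* b c" using assms(5) Y(2) by (auto simp: into_def)
  show "(into (X \<union> Y))\<^sup>*\<^sup>* b p"
  proof (cases "p \<in> X")
    case True
    then have "(into X)\<^sup>*\<^sup>* b p" using X by (simp add: lattice_connected_def)
    then show ?thesis by (rule into_mono) blast
  next
    case False
    then have "(into Y)\<^sup>*\<^sup>* c p" using Y p by (simp add: lattice_connected_def)
    then have "(into (X \<union> Y))\<^sup>*\<^sup>* c p" by (rule into_mono) blast
    then show ?thesis by (rule rtranclp_trans[OF bc])
  qed
qed

lemma lattice_connected_singleton: "lattice_connected {p}"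
  by (simp add: lattice_connected_def)

lemma lattice_connected_tree:
  assumes T: "tree T r par rk"
  shows "lattice_connected T"
proof (rule lattice_connectedI)
  show "r \<in> T" using T by (simp add: tree_def)
  show "(into T)\<^sup>*\<^sup>* r p" if "p \<in> T" for p
    using that
  proof (induction "rk p" arbitrary: p rule: less_induct)
    case less
    show ?case
    proof (cases "p = r")
      case False
      note q = tree_par[OF T less.prems False]
      have "into T (par p) p" using q less.prems by (simp add: into_def adj_sym)
      then show ?thesis using less.hyps[OF q(3,1)] by (rule rtranclp.rtrancl_into_rtrancl[rotated])
    qed simp
  qed
qed

lemma lattice_connected_box:
  assumes N: "1 \<le> N"
  shows "lattice_connected (box N)"
proof (rule lattice_connectedI)
  have F: "frame N \<subseteq> box N" by (auto simp: frame_def)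
  show "(0, 0) \<in> box N" using N by (simp add: box_def)
  fix p assume p: "p \<in> box N"
  obtain a b where ab: "p = (a, b)" by (cases p)
  have "(0, 0) \<in> frame N" "(0, b) \<in> frame N" using p N by (auto simp: ab frame_def box_def)
  then have "(into (frame N))\<^sup>*\<^sup>* (0, 0) (0, b)"
    using lattice_connected_tree[OF tree_frame[OF N]] by (simp add: lattice_connected_def)
  then have start: "(into (box N))\<^sup>*\<^sup>* (0, 0) (0, b)" using F by (rule into_mono)
  have "(into (box N))\<^sup>*\<^sup>* (0, 0) (int n, b)" if "int n \<le> N" for n
    using that
  proof (induction n)
    case (Suc n)
    have "into (box N) (int n, b) (int (Suc n), b)"
      using adj_Hor[of "int n" b] Suc.prems p by (auto simp: into_def box_def ab add.commute)
    then show ?case using Suc.IH Suc.prems by (auto intro: rtranclp.rtrancl_into_rtrancl)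
  qed (use start in simp)
  from this[of "nat a"] show "(into (box N))\<^sup>*\<^sup>* (0, 0) p" using p by (auto simp: ab box_def)
qed

text \<open>Uncovered points are given away one at a time, each to a single set adjacent to it.
  Hence sets stay connected and no intersection grows.\<close>

lemma cover_by_connected:
  assumes B: "finite B" "lattice_connected B" and S: "\<And>i. i \<in> I \<Longrightarrow> S i \<subseteq> B \<and> lattice_connected (S i)"
    and "i0 \<in> I" "S i0 \<noteq> {}"
  shows "\<exists>S'. (\<forall>i\<in>I. S i \<subseteq> S' i \<and> S' i \<subseteq> B \<and> lattice_connected (S' i)) \<and> (\<Union>i\<in>I. S' i) = B \<and>
    (\<forall>i\<in>I. \<forall>j\<in>I. i \<noteq> j \<longrightarrow> S' i \<inter> S' j = S i \<inter> S j)"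
  using S assms(5)
proof (induction "card (B - (\<Union>i\<in>I. S i))" arbitrary: S rule: less_induct)
  case less
  let ?U = "\<Union>i\<in>I. S i"
  show ?case
  proof (cases "B \<subseteq> ?U")
    case True
    then have "?U = B" using less.prems(1) by blast
    then show ?thesis using less.prems(1) by (intro exI[of _ S]) blast
  next
    case False
    then obtain p where p: "p \<in> B" "p \<notin> ?U" by blast
    obtain q where q: "q \<in> S i0" using less.prems(2) by blast
    then have qB: "q \<in> B \<inter> ?U" using less.prems(1) assms(4) by blast
    then have "(into B)\<^sup>*\<^sup>* q p" using B(2) p by (simp add: lattice_connected_def)
    from into_exit[OF this qB] p(2) obtain c b where c: "c \<in> B" "c \<notin> ?U" "b \<in> ?U" "adj b c" by blast
    then obtain i where i: "i \<in> I" "b \<in> S i" by blast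
    define R where "R = S(i := S i \<union> {c})"
    have R: "R j \<subseteq> B \<and> lattice_connected (R j)" if "j \<in> I" for j
    proof (cases "j = i")
      case True
      have "lattice_connected (S i \<union> {c})"
        using less.prems(1)[OF i(1)] lattice_connected_Un[OF _ i(2) lattice_connected_singleton,
            of c] c(4) by blast
      then show ?thesis using True less.prems(1)[OF i(1)] c(1) by (simp add: R_def)
    qed (use less.prems(1)[OF that] in \<open>simp add: R_def\<close>)
    have sub: "S j \<subseteq> R j" for j by (auto simp: R_def)
    have "B - (\<Union>i\<in>I. R i) \<subset> B - ?U"
    proof
      show "B - (\<Union>i\<in>I. R i) \<subseteq> B - ?U" using sub by blast
      have "c \<in> R i" by (simp add: R_def)
      then show "B - (\<Union>i\<in>I. R i) \<noteq> B - ?U" using c(1,2) i(1) by blast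
    qed
    then have "card (B - (\<Union>i\<in>I. R i)) < card (B - ?U)" using B(1) by (intro psubset_card_mono) simp_all
    moreover have "R i0 \<noteq> {}" using less.prems(2) sub by blast
    ultimately have "\<exists>S'. (\<forall>i\<in>I. R i \<subseteq> S' i \<and> S' i \<subseteq> B \<and> lattice_connected (S' i)) \<and> (\<Union>i\<in>I. S' i) = B \<and>
      (\<forall>i\<in>I. \<forall>j\<in>I. i \<noteq> j \<longrightarrow> S' i \<inter> S' j = R i \<inter> R j)"
      by (intro less.hyps R)
    then obtain S' where S': "\<forall>i\<in>I. R i \<subseteq> S' i \<and> S' i \<subseteq> B \<and> lattice_connected (S' i)" "(\<Union>i\<in>I. S' i) = B"
      "\<forall>i\<in>I. \<forall>j\<in>I. i \<noteq> j \<longrightarrow> S' i \<inter> S' j = R i \<inter> R j" by (elim exE conjE)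
    have "R k \<inter> R j = S k \<inter> S j" if "k \<in> I" "j \<in> I" "k \<noteq> j" for k j
    proof -
      have "c \<notin> S k" "c \<notin> S j" using c(2) that by blast+
      then show ?thesis using that(3) by (cases "k = i"; cases "j = i") (simp_all add: R_def)
    qed
    moreover have "\<forall>i\<in>I. S i \<subseteq> S' i" using S'(1) sub by blast
    ultimately show ?thesis using S' by (intro exI[of _ S']) simp
  qed
qed

text \<open>The points at sup-distance less than 1 from \<open>q\<close>, after scaling and a shift.
  Radius 1 makes the cell nonempty, and the strict inequality makes membership an open condition on
  \<open>q\<close>.\<close>

definition cell :: "real \<Rightarrow> int \<Rightarrow> real ^ 2 \<Rightarrow> point set" where
  "cell h m q = {(a, b). \<bar>of_int a - (q $ 1 / h + of_int m)\<bar> < 1 \<and>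
      \<bar>of_int b - (q $ 2 / h + of_int m)\<bar> < 1}"

lemma cell_nonempty: "cell h m q \<noteq> {}"
proof -
  have "(\<lfloor>q $ 1 / h + of_int m\<rfloor>, \<lfloor>q $ 2 / h + of_int m\<rfloor>) \<in> cell h m q"
    unfolding cell_def by (simp, linarith)
  then show ?thesis by blast
qed

lemma adj_or_eq: "\<bar>a - a'\<bar> \<le> 1 \<Longrightarrow> a = a' \<or> adj (a, b) (a', b)"
    "\<bar>b - b'\<bar> \<le> 1 \<Longrightarrow> b = b' \<or> adj (a, b) (a, b')"
  for a a' b b' :: int
proof -
  have "a' = a \<or> a' = a + 1 \<or> a = a' + 1" if "\<bar>a - a'\<bar> \<le> 1" for a a' :: int using that by arith
  then show "\<bar>a - a'\<bar> \<le> 1 \<Longrightarrow> a = a' \<or> adj (a, b) (a', b)" "\<bar>b - b'\<bar> \<le> 1 \<Longrightarrow> b = b' \<or> adj (a, b) (a, b')"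
    using adj_Hor adj_Ver adj_sym by metis+
qed

lemma lattice_connected_cell: "lattice_connected (cell h m q)"
  unfolding lattice_connected_def
proof (intro ballI)
  let ?X = "cell h m q"
  fix p p' assume pp: "p \<in> ?X" "p' \<in> ?X"
  obtain a b a' b' where ab: "p = (a, b)" "p' = (a', b')" by (cases p; cases p')
  have "\<bar>real_of_int a - of_int a'\<bar> < 2" "\<bar>real_of_int b - of_int b'\<bar> < 2"
    using pp unfolding ab cell_def by (simp, linarith)+
  then have "\<bar>a - a'\<bar> \<le> 1" "\<bar>b - b'\<bar> \<le> 1" by linarith+
  moreover have "(a', b) \<in> ?X" using pp unfolding ab cell_def by simp
  ultimately have "(into ?X)\<^sup>*\<^sup>* (a, b) (a', b)" "(into ?X)\<^sup>*\<^sup>* (a', b) (a', b')"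
    using adj_or_eq pp unfolding into_def ab by blast+
  then show "(into ?X)\<^sup>*\<^sup>* p p'" unfolding ab by (rule rtranclp_trans)
qed

text \<open>Cells of nearby points of \<open>C\<close> share a lattice point, so the relation of
  being linked within the union is locally constant on the connected set \<open>C\<close>.\<close>

lemma lattice_connected_cells:
  assumes C: "topological_space_class.connected C"
  shows "lattice_connected (\<Union>q\<in>C. cell h m q)"
  unfolding lattice_connected_def
proof (intro ballI)
  let ?X = "\<Union>q\<in>C. cell h m q"
  fix p p' assume "p \<in> ?X" "p' \<in> ?X"
  then obtain q q' where q: "q \<in> C" "p \<in> cell h m q" and q': "q' \<in> C" "p' \<in> cell h m q'" by blast
  define R where "R x y \<longleftrightarrow> (\<forall>p\<in>cell h m x. \<forall>p'\<in>cell h m y. (into ?X)\<^sup>*\<^sup>* p p')" for x y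
  have "R q q'"
  proof (rule connected_equivalence_relation[OF C q(1) q'(1)])
    fix x y assume xy: "R x y" "x \<in> C" "y \<in> C"
    have "(into ?X)\<^sup>*\<^sup>* p' p" if "p \<in> cell h m x" "p' \<in> cell h m y" for p p'
    proof (rule into_sym)
      show "(into ?X)\<^sup>*\<^sup>* p p'" using xy(1) that unfolding R_def by blast
      show "p \<in> ?X" using that xy(2) by blast
    qed
    then show "R y x" unfolding R_def by blast
  next
    fix x y z assume "R x y" "R y z"
    moreover obtain p where "p \<in> cell h m y" using cell_nonempty by blast
    ultimately show "R x z" unfolding R_def by (meson rtranclp_trans)
  next
    fix x assume x: "x \<in> C"
    obtain p where p: "p \<in> cell h m x" using cell_nonempty by blast
    obtain a b where ab: "p = (a, b)" by (cases p)
    define T where "T = C \<inter> {y. p \<in> cell h m y}"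
    have "open {y :: real ^ 2. \<bar>of_int a - (y $ 1 / h + of_int m)\<bar> < 1}"
      "open {y :: real ^ 2. \<bar>of_int b - (y $ 2 / h + of_int m)\<bar> < 1}"
      unfolding divide_inverse by (intro open_Collect_less continuous_intros)+
    then have "open {y. p \<in> cell h m y}" by (simp add: ab cell_def open_Collect_conj)
    then have "openin (top_of_set C) T" unfolding T_def by (rule openin_open_Int)
    moreover have "R x y" if "y \<in> T" for y
      unfolding R_def
    proof (intro ballI)
      fix p1 p2 assume p1: "p1 \<in> cell h m x" and p2: "p2 \<in> cell h m y"
      have y: "y \<in> C" "p \<in> cell h m y" using that by (simp_all add: T_def)
      have "(into (cell h m x))\<^sup>*\<^sup>* p1 p" using lattice_connected_cell p1 p
          unfolding lattice_connected_def by blast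
      then have "(into ?X)\<^sup>*\<^sup>* p1 p" by (rule into_mono) (use x in blast)
      moreover have "(into (cell h m y))\<^sup>*\<^sup>* p p2" using lattice_connected_cell p2 y
          unfolding lattice_connected_def by blast
      then have "(into ?X)\<^sup>*\<^sup>* p p2" by (rule into_mono) (use y in blast)
      ultimately show "(into ?X)\<^sup>*\<^sup>* p1 p2" by (rule rtranclp_trans)
    qed
    ultimately show "\<exists>T. openin (top_of_set C) T \<and> x \<in> T \<and> (\<forall>y\<in>T. R x y)" using x p by (auto simp: T_def)
  qed
  then show "(into ?X)\<^sup>*\<^sup>* p p'" using q(2) q'(2) unfolding R_def by blast
qed

lemma dist_less_if_cells_meet:
  assumes "0 < h" "cell h m q \<inter> cell h m q' \<noteq> {}"
  shows "dist q q' < 4 * h"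
proof -
  obtain a b where ab: "(a, b) \<in> cell h m q" "(a, b) \<in> cell h m q'" using assms(2) by auto
  have "\<bar>q $ i / h - q' $ i / h\<bar> < 2" if "i = 1 \<or> i = 2" for i
    using ab that unfolding cell_def by (elim disjE) (simp, linarith)+
  then have "\<bar>q $ i - q' $ i\<bar> < 2 * h" if "i = 1 \<or> i = 2" for i
    using that assms(1) by (simp add: diff_divide_distrib[symmetric] abs_divide divide_less_eq)
  from this[of 1] this[of 2] have "\<bar>(q - q') $ 1\<bar> + \<bar>(q - q') $ 2\<bar> < 4 * h" by simp
  moreover have "norm (q - q') \<le> \<bar>(q - q') $ 1\<bar> + \<bar>(q - q') $ 2\<bar>"
    using norm_le_l1_cart[of "q - q'"] by (simp add: sum_2)
  ultimately show ?thesis by (simp add: dist_norm)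
qed

text \<open>Disjoint compact sets have a positive distance, and there are finitely many pairs. Cells
  that meet belong to points less than four mesh widths apart, so a quarter of the smallest gap is a
  fine enough mesh.\<close>

lemma discretise:
  fixes C :: "'a \<Rightarrow> (real ^ 2) set"
  assumes V: "finite V" and "\<forall>v\<in>V. compact (C v) \<and> topological_space_class.connected (C v)"
  shows "\<exists>N S. 1 \<le> N \<and> (\<forall>v\<in>V. S v \<subseteq> {1..<N} \<times> {1..<N} \<and> lattice_connected (S v) \<and> (S v = {} \<longleftrightarrow>
      C v = {})) \<and>
    (\<forall>u\<in>V. \<forall>v\<in>V. S u \<inter> S v \<noteq> {} \<longleftrightarrow> C u \<inter> C v \<noteq> {})"
proof -
  note C = bspec[OF assms(2)]
  have "\<exists>d>0. C u \<inter> C v = {} \<longrightarrow> (\<forall>x\<in>C u. \<forall>y\<in>C v. d \<le> dist x y)" if uv: "u \<in> V" "v \<in> V" for u v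
    using separate_compact_closed[of "C u" "C v"] C[OF uv(1)] C[OF uv(2)] compact_imp_closed
        zero_less_one by metis
  then obtain d where d: "\<And>u v. u \<in> V \<Longrightarrow> v \<in> V \<Longrightarrow> 0 < d u v \<and>
      (C u \<inter> C v = {} \<longrightarrow> (\<forall>x\<in>C u. \<forall>y\<in>C v. d u v \<le> dist x y))" by metis
  define \<delta> where "\<delta> = Min (insert 1 ((\<lambda>(u, v). d u v) ` (V \<times> V)))"
  have fin: "finite (insert 1 ((\<lambda>(u, v). d u v) ` (V \<times> V)))" using V by simp
  have \<delta>: "0 < \<delta>" unfolding \<delta>_def using fin d by (subst Min_gr_iff) auto
  have \<delta>_le: "\<delta> \<le> d u v" if "u \<in> V" "v \<in> V" for u v
    unfolding \<delta>_def using fin that by (intro Min_le) auto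
  define h where "h = \<delta> / 4"
  have h: "0 < h" using \<delta> by (simp add: h_def)
  have "bounded (\<Union>v\<in>V. C v)" using V C by (intro bounded_UN) (auto intro: compact_imp_bounded)
  then obtain r where r: "\<And>q. q \<in> (\<Union>v\<in>V. C v) \<Longrightarrow> norm q \<le> r" by (auto simp: bounded_iff)
  \<comment> \<open>The shift makes all coordinates positive; the summand 2 leaves room for the
    cells, so that the frame of the box remains free.\<close>
  define m where "m = \<lceil>\<bar>r\<bar> / h\<rceil> + 2"
  define S where "S v = (\<Union>q\<in>C v. cell h m q)" for v
  have coord: "1 \<le> a \<and> a < 2 * m" if "\<bar>of_int a - (q $ i / h + of_int m)\<bar> < 1" "q \<in> C v"
      "v \<in> V" for a :: int and q i v
  proof -
    have "\<bar>q $ i\<bar> \<le> \<bar>r\<bar>" using component_le_norm_cart[of q i] r[of q] that by fastforce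
    then have "\<bar>q $ i / h\<bar> \<le> \<bar>r\<bar> / h" using h by (simp add: divide_right_mono)
    moreover have "\<bar>r\<bar> / h \<le> of_int m - 2" unfolding m_def by simp
    ultimately have "0 < real_of_int a" "real_of_int a < of_int (2 * m)" using that(1) by (simp_all,
        linarith+)
    then show ?thesis by linarith
  qed
  have "0 \<le> \<bar>r\<bar> / h" using h by simp
  then have "0 \<le> \<lceil>\<bar>r\<bar> / h\<rceil>" unfolding zero_le_ceiling by linarith
  then have 1: "1 \<le> 2 * m" unfolding m_def by simp
  have 2: "S v \<subseteq> {1..<2 * m} \<times> {1..<2 * m}" if "v \<in> V" for v
    using coord that by (auto simp: S_def cell_def)
  have 3: "lattice_connected (S v)" if "v \<in> V" for v
    unfolding S_def using C[OF that] by (intro lattice_connected_cells) simp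
  have 4: "S v = {} \<longleftrightarrow> C v = {}" for v using cell_nonempty by (auto simp: S_def)
  have 5: "S u \<inter> S v \<noteq> {} \<longleftrightarrow> C u \<inter> C v \<noteq> {}" if uv: "u \<in> V" "v \<in> V" for u v
  proof
    assume "C u \<inter> C v \<noteq> {}"
    then obtain q where "q \<in> C u" "q \<in> C v" by blast
    then show "S u \<inter> S v \<noteq> {}" using cell_nonempty[of h m q] unfolding S_def by blast
  next
    assume "S u \<inter> S v \<noteq> {}"
    then obtain q q' where q: "q \<in> C u" "q' \<in> C v" "cell h m q \<inter> cell h m q' \<noteq> {}" unfolding S_def
        by blast
    have "dist q q' < d u v" using dist_less_if_cells_meet[OF h q(3)] \<delta>_le[OF uv] by (simp add: h_def)
    then show "C u \<inter> C v \<noteq> {}" using d[OF uv] q(1,2) by fastforce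
  qed
  show ?thesis by (intro exI[of _ "2 * m"] exI[of _ S] conjI ballI 1 2 3 4 5)
qed

text \<open>The frame joins the covering under the extra index \<open>None\<close>. It is disjoint
  from the discretised curves, so its enlarged set is disjoint from all others and can be merged
  into a neighbouring one without creating an adjacency.\<close>

lemma string_graph_cops_suffice:
  fixes G :: "'a pair_pre_digraph"
  assumes G: "pair_graph G" and conn: "Digraph_Component.connected (with_proj G)" and "string_graph G"
  shows "cops_suffice G 12"
proof -
  interpret pair_graph G by fact
  let ?V = "pverts G"
  obtain \<psi> :: "'a \<Rightarrow> real \<Rightarrow> real ^ 2" where \<psi>: "\<And>v. v \<in> ?V \<Longrightarrow> simple_path (\<psi> v)"
    and meet: "\<And>u v. u \<in> ?V \<Longrightarrow> v \<in> ?V \<Longrightarrow> u \<noteq> v \<Longrightarrow>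
      (u, v) \<in> parcs G \<longleftrightarrow> path_image (\<psi> u) \<inter> path_image (\<psi> v) \<noteq> {}"
    using assms(3) unfolding string_graph_def by blast
  have ne: "?V \<noteq> {}" and reach: "\<And>u v. u \<in> ?V \<Longrightarrow> v \<in> ?V \<Longrightarrow> u \<rightarrow>\<^sup>*\<^bsub>with_proj (mk_symmetric (with_proj G))\<^esub> v"
    using conn unfolding Digraph_Component.connected_def strongly_connected_def by auto
  have linked: "(step G)\<^sup>*\<^sup>* u v" if uv: "u \<in> ?V" "v \<in> ?V" for u v
    using reach[OF uv] unfolding reachable_def
  proof (induction rule: rtrancl_on_induct)
    case (step y z)
    then have "step G y z" using sym_arcs by (auto simp: step_def parcs_mk_symmetric dest:
        arcs_symmetric)
    then show ?case using step by (meson rtranclp.rtrancl_into_rtrancl)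
  qed simp
  have fin: "finite ?V" by simp
  have "\<forall>v\<in>?V. compact (path_image (\<psi> v)) \<and> topological_space_class.connected (path_image (\<psi> v))"
    using \<psi> by (simp add: compact_simple_path_image connected_simple_path_image)
  from discretise[OF fin this] obtain N S0 where N: "1 \<le> N"
    and S0: "\<forall>v\<in>?V. S0 v \<subseteq> {1..<N} \<times> {1..<N} \<and> lattice_connected (S0 v) \<and> (S0 v = {} \<longleftrightarrow>
        path_image (\<psi> v) = {})"
    and S0_meet: "\<forall>u\<in>?V. \<forall>v\<in>?V. S0 u \<inter> S0 v \<noteq> {} \<longleftrightarrow> path_image (\<psi> u) \<inter> path_image (\<psi> v) \<noteq> {}"
    by (elim exE conjE)
  define F where "F i = (case i of None \<Rightarrow> frame N | Some v \<Rightarrow> S0 v)" for i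
  have inside: "{1..<N} \<times> {1..<N} \<subseteq> box N - frame N" by (auto simp: box_def frame_def)
  have frame_box: "frame N \<subseteq> box N" by (auto simp: frame_def)
  have finbox: "finite (box N)" by (simp add: box_def)
  have origin: "(0, 0) \<in> frame N" using N by (simp add: frame_def box_def)
  have F: "F i \<subseteq> box N \<and> lattice_connected (F i)" if "i \<in> insert None (Some ` ?V)" for i
  proof (cases i)
    case None
    then show ?thesis using frame_box lattice_connected_tree[OF tree_frame[OF N]] by (simp add: F_def)
  next
    case (Some v)
    then have "v \<in> ?V" using that by blast
    then show ?thesis using S0 inside by (simp add: F_def Some) blast
  qed
  have "F None \<noteq> {}" using origin by (auto simp: F_def)
  then have "\<exists>S1. (\<forall>i\<in>insert None (Some ` ?V). F i \<subseteq> S1 i \<and> S1 i \<subseteq> box N \<and> lattice_connected (S1 i)) \<and>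
    (\<Union>i\<in>insert None (Some ` ?V). S1 i) = box N \<and>
    (\<forall>i\<in>insert None (Some ` ?V). \<forall>j\<in>insert None (Some ` ?V). i \<noteq> j \<longrightarrow> S1 i \<inter> S1 j = F i \<inter> F j)"
    by (intro cover_by_connected[OF finbox lattice_connected_box[OF N] _ insertI1[of None
        "Some ` ?V"]] F)
  then obtain S1 where S1: "\<forall>i\<in>insert None (Some ` ?V). F i \<subseteq> S1 i \<and> S1 i \<subseteq> box N \<and>
      lattice_connected (S1 i)"
    and cover: "(\<Union>i\<in>insert None (Some ` ?V). S1 i) = box N"
    and S1_meet: "\<forall>i\<in>insert None (Some ` ?V). \<forall>j\<in>insert None (Some ` ?V). i \<noteq> j \<longrightarrow> S1 i \<inter> S1 j = F i
        \<inter> F j"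
    by (elim exE conjE)
  have None: "frame N \<subseteq> S1 None" "S1 None \<subseteq> box N" "lattice_connected (S1 None)" using S1
      by (auto simp: F_def)
  have Some: "S0 v \<subseteq> S1 (Some v)" "S1 (Some v) \<subseteq> box N" "lattice_connected (S1 (Some v))"
      "S1 (Some v) \<noteq> {}"
    and None_Some: "S1 None \<inter> S1 (Some v) = {}" if v: "v \<in> ?V" for v
  proof -
    have "Some v \<in> insert None (Some ` ?V)" using v by blast
    then have *: "F (Some v) \<subseteq> S1 (Some v) \<and> S1 (Some v) \<subseteq> box N \<and> lattice_connected (S1 (Some v))"
      "S1 None \<inter> S1 (Some v) = F None \<inter> F (Some v)" using S1 S1_meet by blast+
    have "S0 v \<noteq> {}" using S0 v by simp
    then show "S0 v \<subseteq> S1 (Some v)" "S1 (Some v) \<subseteq> box N" "lattice_connected (S1 (Some v))"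
        "S1 (Some v) \<noteq> {}"
      using *(1) by (auto simp: F_def)
    have "S0 v \<subseteq> {1..<N} \<times> {1..<N}" using S0 v by blast
    then show "S1 None \<inter> S1 (Some v) = {}" using *(2) inside by (simp add: F_def) blast
  qed
  \<comment> \<open>The box is connected and fully covered, so the set of the frame is adjacent to
    the set of some vertex.\<close>
  obtain b c v0 where v0: "v0 \<in> ?V" "c \<in> S1 (Some v0)" and b: "b \<in> S1 None" "adj b c"
  proof -
    obtain v where v: "v \<in> ?V" using ne by blast
    then obtain p where p: "p \<in> S1 (Some v)" using Some(4) by blast
    then have pb: "p \<in> box N" "p \<notin> S1 None" using Some(2) None_Some v by blast+
    have "(0, 0) \<in> box N \<inter> S1 None" using origin frame_box None(1) by blast
    moreover from this have "(into (box N))\<^sup>*\<^sup>* (0, 0) p"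
      using lattice_connected_box[OF N] pb unfolding lattice_connected_def by blast
    ultimately obtain c b where c: "c \<in> box N - S1 None" "b \<in> box N \<inter> S1 None" "adj b c"
      using into_exit[of "box N" "(0, 0)" p "S1 None"] pb by blast
    then have "c \<in> (\<Union>i\<in>insert None (Some ` ?V). S1 i)" using cover by blast
    then obtain v0 where "v0 \<in> ?V" "c \<in> S1 (Some v0)" using c(1) by blast
    then show ?thesis using that c by blast
  qed
  define S where "S v = (if v = v0 then S1 (Some v0) \<union> S1 None else S1 (Some v))" for v
  interpret string_system G S
  proof
    fix v assume v: "v \<in> ?V"
    show "finite (S v)"
      using Some(2)[OF v] Some(2)[OF v0(1)] None(2) finbox by (auto simp: S_def intro: finite_subset)
    show "S v \<noteq> {}" using Some(4)[OF v] Some(4)[OF v0(1)] by (simp add: S_def)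
    show "lattice_connected (S v)"
      using lattice_connected_Un[OF Some(3)[OF v0(1)] v0(2) None(3) b(1)] adj_sym[OF b(2)] Some(3)[OF v]
      by (simp add: S_def)
    fix u assume u: "u \<in> ?V"
    show "(step G)\<^sup>*\<^sup>* u v" by (rule linked[OF u v])
    show "step G u v \<longleftrightarrow> S u \<inter> S v \<noteq> {}"
    proof (cases "u = v")
      case True
      then show ?thesis using \<open>S v \<noteq> {}\<close> by (simp add: step_refl)
    next
      case False
      have "S u \<inter> S v = S1 (Some u) \<inter> S1 (Some v)"
        using None_Some[OF u] None_Some[OF v] False by (auto simp: S_def)
      also have "\<dots> = S0 u \<inter> S0 v" using S1_meet u v False by (simp add: F_def)
      finally show ?thesis using S0_meet meet[OF u v False] u v False by (simp add: step_def)
    qed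
  qed
  show ?thesis
  proof (rule cops_suffice_12[OF N v0(1)])
    show "frame N \<subseteq> S v0" using None(1) by (auto simp: S_def)
    have "(\<Union>v\<in>?V. S v) = (\<Union>i\<in>insert None (Some ` ?V). S1 i)" using v0(1)
        by (auto simp: S_def split: if_splits)
    then show "(\<Union>v\<in>?V. S v) = box N" using cover by simp
  qed
qed

theorem theorem3:
  fixes G :: "'a pair_pre_digraph"
  assumes "pair_graph G" and "Digraph_Component.connected (with_proj G)"
    and "string_graph G"
  shows "cop_number G \<le> 13"
proof -
  have "cop_number G \<le> 12"
    unfolding cop_number_def using string_graph_cops_suffice[OF assms] by (rule Least_le)
  then show ?thesis by simp
qed

end
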